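(* For all $x,y\in U_q^-(\mathfrak g)$, one has $$(x,y)_L=(x,y)_K \mod q\,\mathbf A_0,$$ where $(\ ,\ )_L$ is Lusztig's bilinear form and $(\ ,\ )_K$ is Kashiwara's bilinear form on $U_q^-(\mathfrak g)$.
   Context: Datum. $I$ is a (possibly countably infinite) index set and $A=(a_{ij})_{i,j\in I}$ is an even symmetrizable Borcherds-Cartan matrix: $a_{ij}\in\mathbb Z$, $a_{ii}\in\{2,0,-2,-4,\dots\}$, $a_{ij}\le 0$ for $i\neq j$, and there are $s_i\in\mathbb Z_{>0}$ with $s_ia_{ij}=s_ja_{ji}$. $I^{\mathrm{re}}=\{i: a_{ii}=2\}$, $I^{\mathrm{im}}=\{i:a_{ii}\le0\}$, $I^{\mathrm{iso}}=\{i:a_{ii}=0\}$, $I^\infty=I^{\mathrm{re}}\cup(I^{\mathrm{im}}\times\mathbb Z_{>0})$; $i\in I^{\mathrm{re}}$ is treated as a pair $(i,l)$ with $l=1$. The simple roots $\alpha_i$ are linearly independent, with $(\alpha_i,\alpha_j)=s_ia_{ij}$; $q$ is an indeterminate, $q_i=q^{s_i}$, $q_{(i)}=q^{(\alpha_i,\alpha_i)/2}$. $\mathbf A_0\subset\mathbb Q(q)$ is the ring of rational functions regular at $q=0$. Lusztig's form. $\mathscr F=\mathbb Q(q)\langle f_{il}\mid (i,l)\in I^\infty\rangle$ is the free associative algebra, graded by $|f_{il}|=-l\alpha_i$. $\mathscr F\otimes\mathscr F$ has the multiplication $(x_1\otimes x_2)(y_1\otimes y_2)=q^{-(|x_2|,|y_1|)}x_1y_1\otimes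 x_2y_2$, and $\delta:\mathscr F\to\mathscr F\otimes\mathscr F$ is the algebra homomorphism with $\delta(f_{il})=\sum_{m+n=l}q_{(i)}^{-mn}f_{im}\otimes f_{in}$ ($f_{i0}=1$). Given nonzero $\nu_{il}\in\mathbb Q(q)$, $(\ ,\ )_L$ is the symmetric bilinear form on $\mathscr F$ with $(1,1)_L=1$, $(f_{il},f_{il})_L=\nu_{il}$, $(x,y)_L=0$ if $|x|\ne|y|$, and $(x,yz)_L=(\delta(x),y\otimes z)_L$ (with $(x_1\otimes x_2,y\otimes z)_L=(x_1,y)_L(x_2,z)_L$). It is assumed that $\nu_{il}\equiv1 \bmod q\mathbb Z_{\ge0}[[q]]$ for $i\in I^{\mathrm{im}}\setminus I^{\mathrm{iso}}$. The negative half of the quantum Borcherds-Bozec algebra is $U_q^-(\mathfrak g)=\mathscr F/\mathscr R$, where $\mathscr R$ is the radical of the form; $(\ ,\ )_L$ and $\delta$ descend to it. Primitive generators. For $i\in I^{\mathrm{im}}$, $l>0$, $\mathtt b_{il}\in U_q^-(\mathfrak g)$ is the unique element with $\mathtt b_{il}-f_{il}\in\mathbb Q(q)\langle f_{ik}\mid k<l\rangle$ and $(\mathtt b_{il},w)_L=0$ for all $w\in\mathbb Q(q)\langle f_{ik}\mid k<l\rangle$; for $i\in I^{\mathrm{re}}$, $\mathtt b_i=f_i$. The elements $\mathtt b_{il}$ generate $U_q^-(\mathfrak g)$ and satisfy $\delta(\mathtt b_{il})=\mathtt b_{il}\otimes1+1\otimes\mathtt b_{il}$. Throughout, the normalization is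 $(\mathtt b_{il},\mathtt b_{il})_L=(1-q_i^{2l})^{-1}$ for all $(i,l)\in I^\infty$. Kashiwara's form. $e'_{il}$ ($(i,l)\in I^\infty$) is the linear operator on $U_q^-(\mathfrak g)$ with $e'_{il}(1)=0$ and $e'_{il}(\mathtt b_{jk}S)=\delta_{ij}\delta_{kl}S+q_i^{-kla_{ij}}\mathtt b_{jk}e'_{il}(S)$. $(\ ,\ )_K$ is the unique nondegenerate symmetric bilinear form on $U_q^-(\mathfrak g)$ with $(1,1)_K=1$ and $(\mathtt b_{il}S,T)_K=(S,e'_{il}T)_K$ for all $S,T\in U_q^-(\mathfrak g)$.
   Formalization: For arbitrary x,y the claim fails (x=q^{-n}b_il, y=b_il, n large), so it is proved for x,y whose components x_β,y_β, graded by how often each primitive generator b_il occurs, satisfy (x_β,y_β)_K ∈ A_0 for all β. *)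

theory Defs
  imports
    "HOL-Computational_Algebra.Fraction_Field"
    "HOL-Computational_Algebra.Polynomial_FPS"
    "HOL-Library.Poly_Mapping"
    "HOL-Library.Multiset"
    "HOL-Library.Countable"
    "HOL-Algebra.QuotRing"
begin

text \<open>The field \<open>\<rat>(q)\<close> is \<^typ>\<open>rat poly fract\<close>.\<close>

type_synonym ratfun = "rat poly fract"

definition qv :: ratfun where
  "qv = Fraction_Field.Fract [:0, 1:] 1"

definition A0 :: "ratfun set" where
  "A0 = {Fraction_Field.Fract p r | p r. poly r 0 \<noteq> 0}"

definition qA0 :: "ratfun set" where
  "qA0 = (\<lambda>z. qv * z) ` A0"

text \<open>\<open>fps_expansion_of r g\<close>: the expansion of \<open>r\<close> at \<open>q = 0\<close> is the power series \<open>g\<close>.\<close>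

definition fps_expansion_of :: "ratfun \<Rightarrow> rat fps \<Rightarrow> bool" where
  "fps_expansion_of r g \<longleftrightarrow>
     (\<exists>p d. d \<noteq> 0 \<and> r = Fraction_Field.Fract p d \<and> fps_of_poly p = g * fps_of_poly d)"

definition one_mod_q_nonneg :: "ratfun \<Rightarrow> bool" where
  "one_mod_q_nonneg r \<longleftrightarrow>
     (\<exists>g. fps_expansion_of r g \<and> fps_nth g 0 = 1 \<and> (\<forall>n>0. fps_nth g n \<in> \<nat>))"


section \<open>Borcherds-Cartan data\<close>

definition borcherds_cartan :: "('i \<Rightarrow> 'i \<Rightarrow> int) \<Rightarrow> ('i \<Rightarrow> int) \<Rightarrow> bool" where
  "borcherds_cartan a s \<longleftrightarrow>
     (\<forall>i. a i i = 2 \<or> (a i i \<le> 0 \<and> even (a i i))) \<and>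
     (\<forall>i j. i \<noteq> j \<longrightarrow> a i j \<le> 0) \<and>
     (\<forall>i. s i > 0) \<and>
     (\<forall>i j. s i * a i j = s j * a j i)"

definition Ire :: "('i \<Rightarrow> 'i \<Rightarrow> int) \<Rightarrow> 'i set" where
  "Ire a = {i. a i i = 2}"

definition Iim :: "('i \<Rightarrow> 'i \<Rightarrow> int) \<Rightarrow> 'i set" where
  "Iim a = {i. a i i \<le> 0}"

definition Iiso :: "('i \<Rightarrow> 'i \<Rightarrow> int) \<Rightarrow> 'i set" where
  "Iiso a = {i. a i i = 0}"

definition Iinf :: "('i \<Rightarrow> 'i \<Rightarrow> int) \<Rightarrow> ('i \<times> nat) set" where
  "Iinf a = Ire a \<times> {1} \<union> Iim a \<times> {l. l > 0}"

text \<open>Elements of the root lattice are finitely supported integer vectors; the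
  coordinate at \<open>i\<close> is the coefficient of \<open>\<alpha>\<^sub>i\<close>.\<close>

definition root_form :: "('i \<Rightarrow> 'i \<Rightarrow> int) \<Rightarrow> ('i \<Rightarrow> int) \<Rightarrow> ('i \<Rightarrow>\<^sub>0 int) \<Rightarrow> ('i \<Rightarrow>\<^sub>0 int) \<Rightarrow> int" where
  "root_form a s \<mu> \<nu> =
     (\<Sum>i\<in>Poly_Mapping.keys \<mu>. \<Sum>j\<in>Poly_Mapping.keys \<nu>.
        Poly_Mapping.lookup \<mu> i * Poly_Mapping.lookup \<nu> j * (s i * a i j))"


section \<open>The free algebra and its twisted coproduct\<close>

text \<open>Words form a monoid under concatenation, so that the product of
  \<^typ>\<open>'g list \<Rightarrow>\<^sub>0 ratfun\<close> provided by \<^theory>\<open>HOL-Library.Poly_Mapping\<close> is that of the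
  free associative algebra.\<close>

instantiation list :: (type) monoid_add
begin

definition zero_list :: "'a list" where
  "zero_list = []"

definition plus_list :: "'a list \<Rightarrow> 'a list \<Rightarrow> 'a list" where
  "plus_list = (@)"

instance
  by standard (simp_all add: zero_list_def plus_list_def)

end

type_synonym 'i word = "('i \<times> nat) list"
type_synonym 'i free = "'i word \<Rightarrow>\<^sub>0 ratfun"
type_synonym 'i free2 = "('i word \<times> 'i word) \<Rightarrow>\<^sub>0 ratfun"

definition scl :: "ratfun \<Rightarrow> ('b \<Rightarrow>\<^sub>0 ratfun) \<Rightarrow> ('b \<Rightarrow>\<^sub>0 ratfun)" where
  "scl c x = Poly_Mapping.map (\<lambda>v. c * v) x"

definition words_in :: "('i \<times> nat) set \<Rightarrow> 'i free set" where
  "words_in G = {x. \<forall>w\<in>Poly_Mapping.keys x. set w \<subseteq> G}"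

definition free_alg :: "('i \<Rightarrow> 'i \<Rightarrow> int) \<Rightarrow> 'i free ring" where
  "free_alg a = \<lparr>carrier = words_in (Iinf a), mult = (*), one = 1, zero = 0, add = (+)\<rparr>"

definition gen_word :: "'i \<Rightarrow> nat \<Rightarrow> 'i word" where
  "gen_word i l = (if l = 0 then [] else [(i, l)])"

definition fgen :: "'i \<Rightarrow> nat \<Rightarrow> 'i free" where
  "fgen i l = Poly_Mapping.single (gen_word i l) 1"

definition word_wt :: "'i word \<Rightarrow> ('i \<Rightarrow>\<^sub>0 int)" where
  "word_wt w = (\<Sum>(i, l)\<leftarrow>w. Poly_Mapping.single i (- int l))"

definition homogeneous :: "('i \<Rightarrow>\<^sub>0 int) \<Rightarrow> 'i free \<Rightarrow> bool" where
  "homogeneous \<mu> x \<longleftrightarrow> (\<forall>w\<in>Poly_Mapping.keys x. word_wt w = \<mu>)"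

text \<open>The tensor square has the pairs of words as a basis. Its product is twisted, so it is
  not the product of \<^theory>\<open>HOL-Library.Poly_Mapping\<close>.\<close>

definition tmult :: "('i \<Rightarrow> 'i \<Rightarrow> int) \<Rightarrow> ('i \<Rightarrow> int) \<Rightarrow> 'i free2 \<Rightarrow> 'i free2 \<Rightarrow> 'i free2" where
  "tmult a s t u =
     (\<Sum>(x1, x2)\<in>Poly_Mapping.keys t. \<Sum>(y1, y2)\<in>Poly_Mapping.keys u.
        Poly_Mapping.single (x1 @ y1, x2 @ y2)
          (Poly_Mapping.lookup t (x1, x2) * Poly_Mapping.lookup u (y1, y2) *
           qv powi (- root_form a s (word_wt x2) (word_wt y1))))"

text \<open>Here \<open>q\<^bsub>(i)\<^esub> = q powi (s\<^sub>i a\<^sub>i\<^sub>i / 2)\<close>; the division is exact, as \<open>a\<^sub>i\<^sub>i\<close> is even.\<close>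

definition delta_gen :: "('i \<Rightarrow> 'i \<Rightarrow> int) \<Rightarrow> ('i \<Rightarrow> int) \<Rightarrow> 'i \<times> nat \<Rightarrow> 'i free2" where
  "delta_gen a s g = (case g of (i, l) \<Rightarrow>
     (\<Sum>m\<le>l. Poly_Mapping.single (gen_word i m, gen_word i (l - m))
        (qv powi (- (int m * int (l - m) * (s i * a i i div 2))))))"

fun delta_word :: "('i \<Rightarrow> 'i \<Rightarrow> int) \<Rightarrow> ('i \<Rightarrow> int) \<Rightarrow> 'i word \<Rightarrow> 'i free2" where
  "delta_word a s [] = Poly_Mapping.single ([], []) 1"
| "delta_word a s (g # w) = tmult a s (delta_gen a s g) (delta_word a s w)"

definition delta :: "('i \<Rightarrow> 'i \<Rightarrow> int) \<Rightarrow> ('i \<Rightarrow> int) \<Rightarrow> 'i free \<Rightarrow> 'i free2" where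
  "delta a s x = (\<Sum>w\<in>Poly_Mapping.keys x. scl (Poly_Mapping.lookup x w) (delta_word a s w))"


section \<open>Lusztig's form and the negative half\<close>

text \<open>\<open>tens_form L t y z\<close> is \<open>(t, y \<otimes> z)\<close> for the form induced by \<open>L\<close> on the tensor square.\<close>

definition tens_form :: "('i free \<Rightarrow> 'i free \<Rightarrow> ratfun) \<Rightarrow> 'i free2 \<Rightarrow> 'i free \<Rightarrow> 'i free \<Rightarrow> ratfun" where
  "tens_form L t y z =
     (\<Sum>(u, v)\<in>Poly_Mapping.keys t. Poly_Mapping.lookup t (u, v) *
        L (Poly_Mapping.single u 1) y * L (Poly_Mapping.single v 1) z)"

definition lusztig_form ::
  "('i \<Rightarrow> 'i \<Rightarrow> int) \<Rightarrow> ('i \<Rightarrow> int) \<Rightarrow> ('i \<times> nat \<Rightarrow> ratfun) \<Rightarrow> ('i free \<Rightarrow> 'i free \<Rightarrow> ratfun) \<Rightarrow> bool" where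
  "lusztig_form a s \<nu> L \<longleftrightarrow>
     (let F = carrier (free_alg a) in
       (\<forall>x\<in>F. \<forall>x'\<in>F. \<forall>y\<in>F. L (x + x') y = L x y + L x' y) \<and>
       (\<forall>c. \<forall>x\<in>F. \<forall>y\<in>F. L (scl c x) y = c * L x y) \<and>
       (\<forall>x\<in>F. \<forall>y\<in>F. L x y = L y x) \<and>
       L 1 1 = 1 \<and>
       (\<forall>(i, l)\<in>Iinf a. L (fgen i l) (fgen i l) = \<nu> (i, l)) \<and>
       (\<forall>x\<in>F. \<forall>y\<in>F. \<forall>\<mu> \<mu>'. homogeneous \<mu> x \<and> homogeneous \<mu>' y \<and> \<mu> \<noteq> \<mu>' \<longrightarrow> L x y = 0) \<and>
       (\<forall>x\<in>F. \<forall>y\<in>F. \<forall>z\<in>F. L x (y * z) = tens_form L (delta a s x) y z))"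

definition form_radical :: "('i \<Rightarrow> 'i \<Rightarrow> int) \<Rightarrow> ('i free \<Rightarrow> 'i free \<Rightarrow> ratfun) \<Rightarrow> 'i free set" where
  "form_radical a L =
     {x \<in> carrier (free_alg a). \<forall>y\<in>carrier (free_alg a). L x y = 0}"

definition Uminus :: "('i \<Rightarrow> 'i \<Rightarrow> int) \<Rightarrow> ('i free \<Rightarrow> 'i free \<Rightarrow> ratfun) \<Rightarrow> 'i free set ring" where
  "Uminus a L = free_alg a Quot form_radical a L"

definition Ucls :: "('i \<Rightarrow> 'i \<Rightarrow> int) \<Rightarrow> ('i free \<Rightarrow> 'i free \<Rightarrow> ratfun) \<Rightarrow> 'i free \<Rightarrow> 'i free set" where
  "Ucls a L x = form_radical a L +>\<^bsub>free_alg a\<^esub> x"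

definition Uscl ::
  "('i \<Rightarrow> 'i \<Rightarrow> int) \<Rightarrow> ('i free \<Rightarrow> 'i free \<Rightarrow> ratfun) \<Rightarrow> ratfun \<Rightarrow> 'i free set \<Rightarrow> 'i free set" where
  "Uscl a L c X = Ucls a L (scl c 1) \<otimes>\<^bsub>Uminus a L\<^esub> X"

text \<open>The value of the form on cosets; it does not depend on the representatives, since
  they differ by elements of the radical.\<close>

definition Lform ::
  "('i free \<Rightarrow> 'i free \<Rightarrow> ratfun) \<Rightarrow> 'i free set \<Rightarrow> 'i free set \<Rightarrow> ratfun" where
  "Lform L X Y = (THE c. \<exists>x\<in>X. \<exists>y\<in>Y. c = L x y)"


section \<open>Primitive generators\<close>

definition Usub ::
  "('i \<Rightarrow> 'i \<Rightarrow> int) \<Rightarrow> ('i free \<Rightarrow> 'i free \<Rightarrow> ratfun) \<Rightarrow> 'i \<Rightarrow> nat \<Rightarrow> 'i free set set" where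
  "Usub a L i l = Ucls a L ` words_in {(i, k) | k. 0 < k \<and> k < l}"

definition primitive_generators ::
  "('i \<Rightarrow> 'i \<Rightarrow> int) \<Rightarrow> ('i free \<Rightarrow> 'i free \<Rightarrow> ratfun) \<Rightarrow> ('i \<times> nat \<Rightarrow> 'i free set) \<Rightarrow> bool" where
  "primitive_generators a L b \<longleftrightarrow>
     (\<forall>i\<in>Ire a. b (i, 1) = Ucls a L (fgen i 1)) \<and>
     (\<forall>i\<in>Iim a. \<forall>l>0.
        b (i, l) \<in> carrier (Uminus a L) \<and>
        b (i, l) \<ominus>\<^bsub>Uminus a L\<^esub> Ucls a L (fgen i l) \<in> Usub a L i l \<and>
        (\<forall>w\<in>Usub a L i l. Lform L (b (i, l)) w = 0))"


section \<open>Kashiwara's operators and form\<close>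

definition kashiwara_derivations ::
  "('i \<Rightarrow> 'i \<Rightarrow> int) \<Rightarrow> ('i \<Rightarrow> int) \<Rightarrow> ('i free \<Rightarrow> 'i free \<Rightarrow> ratfun) \<Rightarrow>
   ('i \<times> nat \<Rightarrow> 'i free set) \<Rightarrow> ('i \<times> nat \<Rightarrow> 'i free set \<Rightarrow> 'i free set) \<Rightarrow> bool" where
  "kashiwara_derivations a s L b e' \<longleftrightarrow>
     (let U = Uminus a L in \<forall>(i, l)\<in>Iinf a.
       (\<forall>X\<in>carrier U. e' (i, l) X \<in> carrier U) \<and>
       (\<forall>X\<in>carrier U. \<forall>Y\<in>carrier U. e' (i, l) (X \<oplus>\<^bsub>U\<^esub> Y) = e' (i, l) X \<oplus>\<^bsub>U\<^esub> e' (i, l) Y) \<and>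
       (\<forall>c. \<forall>X\<in>carrier U. e' (i, l) (Uscl a L c X) = Uscl a L c (e' (i, l) X)) \<and>
       e' (i, l) \<one>\<^bsub>U\<^esub> = \<zero>\<^bsub>U\<^esub> \<and>
       (\<forall>(j, k)\<in>Iinf a. \<forall>S\<in>carrier U.
          e' (i, l) (b (j, k) \<otimes>\<^bsub>U\<^esub> S) =
            (if i = j \<and> l = k then S else \<zero>\<^bsub>U\<^esub>) \<oplus>\<^bsub>U\<^esub>
            Uscl a L (qv powi (s i * (- (int k * int l * a i j)))) (b (j, k) \<otimes>\<^bsub>U\<^esub> e' (i, l) S)))"

definition kashiwara_form ::
  "('i \<Rightarrow> 'i \<Rightarrow> int) \<Rightarrow> ('i free \<Rightarrow> 'i free \<Rightarrow> ratfun) \<Rightarrow>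
   ('i \<times> nat \<Rightarrow> 'i free set) \<Rightarrow> ('i \<times> nat \<Rightarrow> 'i free set \<Rightarrow> 'i free set) \<Rightarrow>
   ('i free set \<Rightarrow> 'i free set \<Rightarrow> ratfun) \<Rightarrow> bool" where
  "kashiwara_form a L b e' K \<longleftrightarrow>
     (let U = Uminus a L in
       (\<forall>X\<in>carrier U. \<forall>X'\<in>carrier U. \<forall>Y\<in>carrier U. K (X \<oplus>\<^bsub>U\<^esub> X') Y = K X Y + K X' Y) \<and>
       (\<forall>c. \<forall>X\<in>carrier U. \<forall>Y\<in>carrier U. K (Uscl a L c X) Y = c * K X Y) \<and>
       (\<forall>X\<in>carrier U. \<forall>Y\<in>carrier U. K X Y = K Y X) \<and>
       (\<forall>X\<in>carrier U. (\<forall>Y\<in>carrier U. K X Y = 0) \<longrightarrow> X = \<zero>\<^bsub>U\<^esub>) \<and>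
       K \<one>\<^bsub>U\<^esub> \<one>\<^bsub>U\<^esub> = 1 \<and>
       (\<forall>g\<in>Iinf a. \<forall>S\<in>carrier U. \<forall>T\<in>carrier U. K (b g \<otimes>\<^bsub>U\<^esub> S) T = K S (e' g T)))"


section \<open>Where the forms can be compared modulo \<open>q\<close>\<close>

text \<open>\<open>Ucomp a L b \<beta>\<close> is spanned over \<open>\<rat>(q)\<close> by the products of primitive generators in which
  each generator occurs as often as in the multiset \<open>\<beta>\<close>. This refines the grading by weights.\<close>

definition bprod ::
  "('i \<Rightarrow> 'i \<Rightarrow> int) \<Rightarrow> ('i free \<Rightarrow> 'i free \<Rightarrow> ratfun) \<Rightarrow>
   ('i \<times> nat \<Rightarrow> 'i free set) \<Rightarrow> 'i word \<Rightarrow> 'i free set" where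
  "bprod a L b w = foldr (\<lambda>g X. b g \<otimes>\<^bsub>Uminus a L\<^esub> X) w \<one>\<^bsub>Uminus a L\<^esub>"

definition Ucomp ::
  "('i \<Rightarrow> 'i \<Rightarrow> int) \<Rightarrow> ('i free \<Rightarrow> 'i free \<Rightarrow> ratfun) \<Rightarrow>
   ('i \<times> nat \<Rightarrow> 'i free set) \<Rightarrow> ('i \<times> nat) multiset \<Rightarrow> 'i free set set" where
  "Ucomp a L b \<beta> =
     {(\<Oplus>\<^bsub>Uminus a L\<^esub>w\<in>{w. mset w = \<beta>}. Uscl a L (c w) (bprod a L b w)) | c. True}"

text \<open>A congruence of values modulo \<open>q A\<^sub>0\<close> is invariant under rescaling of an argument only by
  elements of \<open>A\<^sub>0\<close>: already \<open>x = q\<^sup>-\<^sup>n b\<close> and \<open>y = b\<close>, for a primitive generator \<open>b\<close>, give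
  \<open>q\<^sup>-\<^sup>n\<close> against \<open>q\<^sup>-\<^sup>n / (1 - q\<^sub>i\<^sup>2\<^sup>l)\<close>. The forms are therefore compared where the values are
  integral: the components of \<open>x\<close> and \<open>y\<close> in the spaces \<open>Ucomp\<close> pair into \<open>A\<^sub>0\<close>. This holds for all \<open>x\<close> and
  \<open>y\<close> in an \<open>A\<^sub>0\<close>-lattice, such as the crystal lattice, which is spanned by elements of these spaces
  and on which \<open>K\<close> is \<open>A\<^sub>0\<close>-valued. Integrality of \<open>K x y\<close> alone does not suffice, since
  polar parts coming from different components may cancel in \<open>K x y\<close>.\<close>

definition integrally_paired ::
  "('i \<Rightarrow> 'i \<Rightarrow> int) \<Rightarrow> ('i free \<Rightarrow> 'i free \<Rightarrow> ratfun) \<Rightarrow>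
   ('i \<times> nat \<Rightarrow> 'i free set) \<Rightarrow> ('i free set \<Rightarrow> 'i free set \<Rightarrow> ratfun) \<Rightarrow>
   'i free set \<Rightarrow> 'i free set \<Rightarrow> bool" where
  "integrally_paired a L b K x y \<longleftrightarrow>
     (\<exists>D X Y. finite D \<and>
        (\<forall>\<beta>\<in>D. set_mset \<beta> \<subseteq> Iinf a \<and> X \<beta> \<in> Ucomp a L b \<beta> \<and> Y \<beta> \<in> Ucomp a L b \<beta> \<and>
                K (X \<beta>) (Y \<beta>) \<in> A0) \<and>
        x = (\<Oplus>\<^bsub>Uminus a L\<^esub>\<beta>\<in>D. X \<beta>) \<and> y = (\<Oplus>\<^bsub>Uminus a L\<^esub>\<beta>\<in>D. Y \<beta>))"

end

theory Submission
  imports Defs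
begin

text \<open>
  Fix representatives \<open>rep g\<close> of the primitive generators \<open>b g\<close> in the free algebra. Contracting
  the left tensor factor of \<open>\<delta> x\<close> against \<open>rep g\<close> gives an operator \<open>D g\<close>, and the identity
  \<open>(x, y z)\<^sub>L = (\<delta> x, y \<otimes> z)\<^sub>L\<close> makes it the adjoint of left multiplication by \<open>rep g\<close>
  (\<open>L_rep_mult\<close>). Since \<open>rep g\<close> is primitive and homogeneous, \<open>D g\<close> is a twisted derivation with the
  same twist as Kashiwara's operator \<open>e' g\<close> (\<open>D_mult\<close>). On generators it is \<open>N g\<close> times the Kronecker
  delta modulo the radical, where \<open>N g = (b g, b g)\<^sub>L\<close> (\<open>D_rep\<close>). Hence \<open>D g\<close> induces \<open>N g\<close> times
  \<open>e' g\<close> on products of generators (\<open>e'_bp\<close>), and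
  \<open>(b g S, T)\<^sub>L = N g (S, e' g T)\<^sub>L\<close>, while \<open>(b g S, T)\<^sub>K = (S, e' g T)\<^sub>K\<close>.
  Moving letters to the right argument one at a time shows that on the span of the products of
  generators with a given multiset \<open>\<beta>\<close> of letters, Lusztig's form is \<open>\<Prod>g\<in>\<beta>. N g\<close> times Kashiwara's
  form, and that spans for different multisets are orthogonal (\<open>compare_bspan\<close>). As
  \<open>N g = 1 / (1 - q\<^sup>n)\<close> with \<open>n > 0\<close>, the factor is congruent to \<open>1\<close> modulo \<open>q A\<^sub>0\<close>, and the claim
  follows by summing over the components.

  What needs care is primitivity. The generators are characterised by orthogonality to the words in
  lower letters, with no condition on weights, and only as classes modulo the radical. It is shown
  that a homogeneous representative exists (\<open>imaginary_representative\<close>); by weights it is then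
  orthogonal to all words with at least two letters (\<open>primitive_representative\<close>).
\<close>

abbreviation supp :: "('b \<Rightarrow>\<^sub>0 'c::zero) \<Rightarrow> 'b set" where "supp \<equiv> Poly_Mapping.keys"
abbreviation cf :: "('b \<Rightarrow>\<^sub>0 'c::zero) \<Rightarrow> 'b \<Rightarrow> 'c" where "cf \<equiv> Poly_Mapping.lookup"
abbreviation mon :: "'b \<Rightarrow> 'c::zero \<Rightarrow> ('b \<Rightarrow>\<^sub>0 'c)" where "mon \<equiv> Poly_Mapping.single"
abbreviation wd :: "'b \<Rightarrow> ('b \<Rightarrow>\<^sub>0 ratfun)" where "wd w \<equiv> Poly_Mapping.single w 1"

section \<open>Linear extension\<close>

lemma lookup_scl [simp]: "cf (scl c x) w = c * cf x w"
  by (simp add: scl_def Poly_Mapping.map.rep_eq when_def)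

lemma scl_add: "scl c (x + y) = scl c x + scl c y"
  by (rule poly_mapping_eqI) (simp add: lookup_add algebra_simps)

lemma scl_add_left: "scl (c + d) x = scl c x + scl d x"
  by (rule poly_mapping_eqI) (simp add: lookup_add algebra_simps)

lemma scl_scl [simp]: "scl c (scl d x) = scl (c * d) x"
  by (rule poly_mapping_eqI) (simp add: algebra_simps)

lemma scl_0 [simp]: "scl c 0 = 0" "scl 0 x = 0"
  by (rule poly_mapping_eqI; simp)+

lemma scl_1 [simp]: "scl 1 x = x"
  by (rule poly_mapping_eqI) simp

lemma scl_uminus_1: "scl (- 1) x = - x"
  by (rule poly_mapping_eqI) simp

lemma scl_diff: "scl c (x - y) = scl c x - scl c y"
  by (rule poly_mapping_eqI) (simp add: lookup_minus algebra_simps)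

lemma scl_mon [simp]: "scl c (mon w d) = mon w (c * d)"
  by (rule poly_mapping_eqI) (simp add: lookup_single when_def)

lemma scl_sum: "scl c (sum f A) = (\<Sum>k\<in>A. scl c (f k))"
  by (induction A rule: infinite_finite_induct) (simp_all add: scl_add)

lemma supp_scl: "supp (scl c x) \<subseteq> supp x"
  by (auto simp: in_keys_iff)

lemma sum_mon_supp: "(\<Sum>w\<in>supp x. mon w (cf x w)) = x"
  by (rule poly_mapping_eqI) (simp add: lookup_sum lookup_single when_def in_keys_iff)

lemma linear_induct [case_names zero add mon]:
  assumes "P 0" "\<And>x y. P x \<Longrightarrow> P y \<Longrightarrow> P (x + y)" "\<And>w c. P (mon w c)"
  shows "P (x :: 'b \<Rightarrow>\<^sub>0 'c::comm_monoid_add)"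
proof -
  have "P (\<Sum>w\<in>A. mon w (cf x w))" if "finite A" for A
    using that by (induction A) (auto intro: assms)
  from this[of "supp x"] show ?thesis by (simp add: sum_mon_supp)
qed

definition lin_ext :: "('b \<Rightarrow> ('c \<Rightarrow>\<^sub>0 ratfun)) \<Rightarrow> ('b \<Rightarrow>\<^sub>0 ratfun) \<Rightarrow> ('c \<Rightarrow>\<^sub>0 ratfun)" where
  "lin_ext f x = (\<Sum>w\<in>supp x. scl (cf x w) (f w))"

lemma lin_ext_superset:
  assumes "finite A" "supp x \<subseteq> A"
  shows "lin_ext f x = (\<Sum>w\<in>A. scl (cf x w) (f w))"
  unfolding lin_ext_def using assms
  by (intro sum.mono_neutral_left) (auto simp: in_keys_iff)

lemma lin_ext_add: "lin_ext f (x + y) = lin_ext f x + lin_ext f y"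
proof -
  have "lin_ext f z = (\<Sum>w\<in>supp x \<union> supp y. scl (cf z w) (f w))" if "z \<in> {x, y, x + y}" for z
    using that keys_add[of x y] by (intro lin_ext_superset) auto
  then show ?thesis by (simp add: lookup_add scl_add_left sum.distrib)
qed

lemma lin_ext_0 [simp]: "lin_ext f 0 = 0"
  by (simp add: lin_ext_def)

lemma lin_ext_sum: "lin_ext f (sum g A) = (\<Sum>k\<in>A. lin_ext f (g k))"
  by (induction A rule: infinite_finite_induct) (simp_all add: lin_ext_add)

lemma lin_ext_mon [simp]: "lin_ext f (mon w c) = scl c (f w)"
  by (subst lin_ext_superset[of "{w}"]) (auto simp: lookup_single)

lemma lin_ext_scl: "lin_ext f (scl c x) = scl c (lin_ext f x)"
  by (induction x rule: linear_induct) (simp_all add: lin_ext_add scl_add)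

lemma lin_ext_fun_add: "lin_ext (\<lambda>w. f w + g w) x = lin_ext f x + lin_ext g x"
  by (simp add: lin_ext_def scl_add sum.distrib)

lemma supp_lin_ext: "supp (lin_ext f x) \<subseteq> (\<Union>w\<in>supp x. supp (f w))"
  unfolding lin_ext_def using keys_sum supp_scl by fastforce

lemma mon_mult_mon: "mon u c * mon v d = mon (u @ v) (c * d)" for u v :: "'b list"
  by (simp add: mult_single plus_list_def)

lemma one_eq_wd_Nil: "1 = wd ([] :: 'b list)"
  using single_one by (metis zero_list_def)

lemma scl_mult_left: "scl c x * y = scl c (x * y)" for x y :: "'b list \<Rightarrow>\<^sub>0 ratfun"
proof (induction x rule: linear_induct)
  case (mon w d)
  show ?case
    by (induction y rule: linear_induct)
      (simp_all add: mon_mult_mon algebra_simps scl_add)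
qed (simp_all add: scl_add algebra_simps)

lemma scl_mult_right: "x * scl c y = scl c (x * y)" for x y :: "'b list \<Rightarrow>\<^sub>0 ratfun"
proof (induction x rule: linear_induct)
  case (mon w d)
  show ?case
    by (induction y rule: linear_induct)
      (simp_all add: mon_mult_mon algebra_simps scl_add)
qed (simp_all add: scl_add algebra_simps)


section \<open>Weights\<close>

lemma root_form_superset:
  assumes "finite A" "finite B" "supp \<mu> \<subseteq> A" "supp \<nu> \<subseteq> B"
  shows "root_form a s \<mu> \<nu> = (\<Sum>i\<in>A. \<Sum>j\<in>B. cf \<mu> i * cf \<nu> j * (s i * a i j))"
proof -
  have "root_form a s \<mu> \<nu> = (\<Sum>i\<in>supp \<mu>. \<Sum>j\<in>B. cf \<mu> i * cf \<nu> j * (s i * a i j))"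
    unfolding root_form_def using assms
    by (intro sum.cong refl sum.mono_neutral_left) (auto simp: in_keys_iff)
  also have "\<dots> = (\<Sum>i\<in>A. \<Sum>j\<in>B. cf \<mu> i * cf \<nu> j * (s i * a i j))"
    using assms by (intro sum.mono_neutral_left) (auto simp: in_keys_iff)
  finally show ?thesis .
qed

lemma root_form_add_left: "root_form a s (\<mu> + \<mu>') \<nu> = root_form a s \<mu> \<nu> + root_form a s \<mu>' \<nu>"
proof -
  have "root_form a s z \<nu> = (\<Sum>i\<in>supp \<mu> \<union> supp \<mu>'. \<Sum>j\<in>supp \<nu>. cf z i * cf \<nu> j * (s i * a i j))"
    if "z \<in> {\<mu>, \<mu>', \<mu> + \<mu>'}" for z
    using that keys_add[of \<mu> \<mu>'] by (intro root_form_superset) auto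
  then show ?thesis by (simp add: lookup_add algebra_simps sum.distrib)
qed

lemma root_form_0 [simp]: "root_form a s 0 \<nu> = 0" "root_form a s \<mu> 0 = 0"
  by (simp_all add: root_form_def)

lemma root_form_single:
  "root_form a s (mon i m) (mon j n) = m * n * (s i * a i j)"
  by (subst root_form_superset[of "{i}" "{j}"]) (auto simp: lookup_single)

lemma word_wt_simps [simp]:
  "word_wt [] = 0" "word_wt ((i, l) # w) = mon i (- int l) + word_wt w"
  "word_wt (u @ v) = word_wt u + word_wt v"
  by (simp_all add: word_wt_def)

lemma lookup_word_wt:
  "cf (word_wt w) j = - int (sum_list (map snd (filter (\<lambda>g. fst g = j) w)))"
  by (induction w) (auto simp: lookup_add lookup_single when_def)

definition positive_word :: "'i word \<Rightarrow> bool" where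
  "positive_word w \<longleftrightarrow> (\<forall>g\<in>set w. 0 < snd g)"

text \<open>The simple roots are linearly independent and all degrees are positive, so no two letters
  of a word can compensate each other in its weight.\<close>

lemma positive_word_of_weight:
  assumes "positive_word w" "word_wt w = mon i (- int l)"
  shows "\<forall>g\<in>set w. fst g = i" "sum_list (map snd w) = l"
proof -
  show *: "\<forall>g\<in>set w. fst g = i"
  proof (rule ccontr)
    assume "\<not> ?thesis"
    then obtain g where g: "g \<in> set w" "fst g \<noteq> i" by auto
    define xs where "xs = map snd (filter (\<lambda>h. fst h = fst g) w)"
    have "cf (word_wt w) (fst g) = 0"
      using g assms(2) by (simp add: lookup_single)
    then have "sum_list xs = 0" unfolding lookup_word_wt xs_def by simp
    moreover have "snd g \<in> set xs" using g by (auto simp: xs_def)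
    ultimately have "snd g = 0" by (simp add: sum_list_eq_0_iff)
    then show False using g assms(1) by (auto simp: positive_word_def)
  qed
  then have "filter (\<lambda>g. fst g = i) w = w" by simp
  then show "sum_list (map snd w) = l"
    using lookup_word_wt[of w i] assms(2) by simp
qed

lemma positive_word_wt_eq_0:
  assumes "positive_word w" "word_wt w = 0"
  shows "w = []"
proof (rule ccontr)
  assume "w \<noteq> []"
  then obtain g w' where w: "w = g # w'" by (cases w) auto
  have "sum_list (map snd w) = 0"
    using positive_word_of_weight(2)[of w _ 0] assms by simp
  then show False using assms(1) w by (simp add: positive_word_def)
qed

lemma letter_less_of_long_word:
  assumes "positive_word w" "2 \<le> length w" "g \<in> set w"
  shows "snd g < sum_list (map snd w)"
proof -
  obtain xs ys where w: "w = xs @ g # ys" using assms(3) by (meson split_list)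
  then obtain h where h: "h \<in> set xs \<union> set ys" using assms(2) by (cases xs; cases ys) auto
  then have "0 < snd h" using assms(1) w by (auto simp: positive_word_def)
  moreover have "snd h \<le> sum_list (map snd xs) + sum_list (map snd ys)"
    using h member_le_sum_list[of "snd h" "map snd xs"] member_le_sum_list[of "snd h" "map snd ys"]
    by force
  ultimately show ?thesis using w by (simp del: add_gr_0)
qed

lemma homogeneous_wd [simp]: "homogeneous (word_wt w) (mon w c)"
  by (simp add: homogeneous_def)

definition twist :: "('i \<Rightarrow> 'i \<Rightarrow> int) \<Rightarrow> ('i \<Rightarrow> int) \<Rightarrow> ('i \<Rightarrow>\<^sub>0 int) \<Rightarrow> ('i \<Rightarrow>\<^sub>0 int) \<Rightarrow> ratfun" where
  "twist a s \<mu> \<nu> = qv powi (- root_form a s \<mu> \<nu>)"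

lemma qv_nonzero [simp]: "qv \<noteq> 0"
  by (simp add: qv_def Zero_fract_def eq_fract)

lemma twist_add_left: "twist a s (\<mu> + \<mu>') \<nu> = twist a s \<mu> \<nu> * twist a s \<mu>' \<nu>"
  by (simp add: twist_def root_form_add_left power_int_add[symmetric])

lemma twist_0 [simp]: "twist a s 0 \<nu> = 1" "twist a s \<mu> 0 = 1"
  by (simp_all add: twist_def)

section \<open>The twisted coproduct\<close>

lemma tmult_eq_lin_ext:
  "tmult a s t u = lin_ext (\<lambda>(x1, x2). lin_ext (\<lambda>(y1, y2).
     mon (x1 @ y1, x2 @ y2) (twist a s (word_wt x2) (word_wt y1))) u) t"
  by (simp add: tmult_def lin_ext_def twist_def scl_sum case_prod_beta mult.assoc)

lemma tmult_add_left: "tmult a s (t + t') u = tmult a s t u + tmult a s t' u"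
  by (simp add: tmult_eq_lin_ext lin_ext_add)

lemma tmult_add_right: "tmult a s t (u + u') = tmult a s t u + tmult a s t u'"
  unfolding tmult_eq_lin_ext lin_ext_add case_prod_unfold by (rule lin_ext_fun_add)

lemma tmult_0 [simp]: "tmult a s 0 u = 0" "tmult a s t 0 = 0"
  by (simp_all add: tmult_def)

lemma tmult_mon:
  "tmult a s (mon (x1, x2) c) (mon (y1, y2) d) =
     mon (x1 @ y1, x2 @ y2) (c * d * twist a s (word_wt x2) (word_wt y1))"
  by (simp add: tmult_eq_lin_ext mult.assoc)

lemma supp_tmult:
  "supp (tmult a s t u) \<subseteq> {(x1 @ y1, x2 @ y2) | x1 x2 y1 y2. (x1, x2) \<in> supp t \<and> (y1, y2) \<in> supp u}"
proof -
  have "\<exists>x1 x2 y1 y2. p = (x1 @ y1, x2 @ y2) \<and> (x1, x2) \<in> supp t \<and> (y1, y2) \<in> supp u"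
    if p: "p \<in> supp (tmult a s t u)" for p
  proof -
    obtain x where x: "x \<in> supp t" and p': "p \<in> supp (case x of (x1, x2) \<Rightarrow> lin_ext (\<lambda>(y1, y2).
       mon (x1 @ y1, x2 @ y2) (twist a s (word_wt x2) (word_wt y1))) u)"
      using subsetD[OF supp_lin_ext p[unfolded tmult_eq_lin_ext]] by blast
    obtain x1 x2 where x12: "x = (x1, x2)" by (cases x)
    obtain y where y: "y \<in> supp u" and p'': "p \<in> supp (case y of (y1, y2) \<Rightarrow>
       mon (x1 @ y1, x2 @ y2) (twist a s (word_wt x2) (word_wt y1)))"
      using subsetD[OF supp_lin_ext p'[unfolded x12 prod.case]] by blast
    then show ?thesis using x x12 by (cases y) (auto split: if_splits)
  qed
  then show ?thesis by blast
qed

text \<open>The coproduct of a letter involves the smaller letters with the same index, and no others.\<close>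

definition letters_closed :: "('i \<times> nat) set \<Rightarrow> bool" where
  "letters_closed G \<longleftrightarrow> (\<forall>i l m. (i, l) \<in> G \<longrightarrow> 0 < m \<longrightarrow> m \<le> l \<longrightarrow> (i, m) \<in> G)"

lemma supp_delta_gen:
  assumes "letters_closed G" "(i, l) \<in> G" "(u, v) \<in> supp (delta_gen a s (i, l))"
  shows "set u \<subseteq> G \<and> set v \<subseteq> G"
proof -
  have "(u, v) \<in> (\<Union>m\<le>l. supp (mon (gen_word i m, gen_word i (l - m))
        (qv powi (- (int m * int (l - m) * (s i * a i i div 2))))))"
    using subsetD[OF keys_sum assms(3)[unfolded delta_gen_def prod.case]] .
  then obtain m where "m \<le> l" "u = gen_word i m" "v = gen_word i (l - m)"
    by (auto split: if_splits)
  then show ?thesis using assms(1,2) by (auto simp: letters_closed_def gen_word_def)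
qed

lemma supp_delta_word:
  assumes "letters_closed G"
  shows "set w \<subseteq> G \<Longrightarrow> (u, v) \<in> supp (delta_word a s w) \<Longrightarrow> set u \<subseteq> G \<and> set v \<subseteq> G"
proof (induction w arbitrary: u v)
  case (Cons g w)
  obtain x1 x2 y1 y2 where uv: "u = x1 @ y1" "v = x2 @ y2" and
    x: "(x1, x2) \<in> supp (delta_gen a s g)" and y: "(y1, y2) \<in> supp (delta_word a s w)"
    using subsetD[OF supp_tmult Cons.prems(2)[unfolded delta_word.simps]] by blast
  have "set x1 \<subseteq> G \<and> set x2 \<subseteq> G"
    using supp_delta_gen[OF assms, of "fst g" "snd g"] x Cons.prems(1) by simp
  moreover have "set y1 \<subseteq> G \<and> set y2 \<subseteq> G"
    using Cons.IH[OF _ y] Cons.prems(1) by simp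
  ultimately show ?case by (simp add: uv)
qed simp

lemma delta_eq_lin_ext: "delta a s = lin_ext (delta_word a s)"
  by (rule ext) (simp add: delta_def lin_ext_def)

lemma supp_delta:
  assumes "letters_closed G" "x \<in> words_in G" "(u, v) \<in> supp (delta a s x)"
  shows "set u \<subseteq> G \<and> set v \<subseteq> G"
proof -
  obtain w where "w \<in> supp x" "(u, v) \<in> supp (delta_word a s w)"
    using subsetD[OF supp_lin_ext assms(3)[unfolded delta_eq_lin_ext]] by blast
  then show ?thesis using supp_delta_word[OF assms(1), of w u v] assms(2) by (simp add: words_in_def)
qed


section \<open>Primitive functionals and twisted derivations\<close>

text \<open>The functional may depend on the right factor as well, so that it can absorb the twists that
  arise when left factors are moved past right factors.\<close>

definition contract_left ::
  "('i word \<Rightarrow> 'i word \<Rightarrow> ratfun) \<Rightarrow> 'i free2 \<Rightarrow> 'i free" where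
  "contract_left \<chi> = lin_ext (\<lambda>(u, v). mon v (\<chi> u v))"

lemma contract_left_add: "contract_left \<chi> (t + t') = contract_left \<chi> t + contract_left \<chi> t'"
  and contract_left_0 [simp]: "contract_left \<chi> 0 = 0"
  and contract_left_mon [simp]: "contract_left \<chi> (mon (u, v) c) = mon v (c * \<chi> u v)"
  and contract_left_sum: "contract_left \<chi> (sum f A) = (\<Sum>k\<in>A. contract_left \<chi> (f k))"
  by (simp_all add: contract_left_def lin_ext_add lin_ext_sum)

text \<open>The factor \<open>twist a s (word_wt v) \<mu>\<close> is what a left tensor factor of weight \<open>\<mu>\<close> picks up
  when it is moved past \<open>v\<close>.\<close>

definition twisted_counit ::
  "('i \<Rightarrow> 'i \<Rightarrow> int) \<Rightarrow> ('i \<Rightarrow> int) \<Rightarrow> ('i \<Rightarrow>\<^sub>0 int) \<Rightarrow> 'i word \<Rightarrow> 'i word \<Rightarrow> ratfun" where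
  "twisted_counit a s \<mu> u v = (if u = [] then twist a s (word_wt v) \<mu> else 0)"

text \<open>Only the terms with both left factors empty survive. The twist of the product is then trivial,
  and that of the counit is multiplicative in the right factor.\<close>

lemma twisted_counit_tmult:
  "contract_left (twisted_counit a s \<mu>) (tmult a s t u) =
   contract_left (twisted_counit a s \<mu>) t * contract_left (twisted_counit a s \<mu>) u"
proof (induction t rule: linear_induct)
  case (mon x c)
  obtain x1 x2 where x: "x = (x1, x2)" by (cases x)
  show ?case
  proof (induction u rule: linear_induct)
    case (mon y d)
    obtain y1 y2 where y: "y = (y1, y2)" by (cases y)
    show ?case
      by (cases "x1 = []"; cases "y1 = []",
          simp_all add: x y tmult_mon mon_mult_mon twisted_counit_def twist_add_left)
        (simp add: algebra_simps)
  qed (simp_all add: tmult_add_right contract_left_add distrib_left)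
qed (simp_all add: tmult_add_left contract_left_add distrib_right)

lemma twisted_counit_delta_word:
  "positive_word w \<Longrightarrow>
   contract_left (twisted_counit a s \<mu>) (delta_word a s w) = mon w (twist a s (word_wt w) \<mu>)"
proof (induction w)
  case (Cons g w)
  obtain i l where g: "g = (i, l)" by (cases g)
  have l: "0 < l" and w: "positive_word w"
    using Cons.prems by (auto simp: g positive_word_def)
  have "contract_left (twisted_counit a s \<mu>) (delta_gen a s g) =
    (\<Sum>m\<le>l. if m = 0 then mon [g] (twist a s (word_wt [g]) \<mu>) else 0)"
    unfolding g delta_gen_def prod.case contract_left_sum
    by (rule sum.cong) (use l in \<open>auto simp: gen_word_def twisted_counit_def\<close>)
  also have "\<dots> = mon [g] (twist a s (word_wt [g]) \<mu>)" by simp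
  finally show ?case
    using Cons.IH[OF w] by (simp add: twisted_counit_tmult mon_mult_mon g twist_add_left)
qed (simp add: twisted_counit_def)

text \<open>A functional \<open>\<phi>\<close> that vanishes on decomposable words, as pairing with a primitive element
  does, and is supported in a single weight.\<close>

locale primitive_functional =
  fixes a :: "'i \<Rightarrow> 'i \<Rightarrow> int" and s :: "'i \<Rightarrow> int"
    and \<phi> :: "'i word \<Rightarrow> ratfun" and \<mu> :: "'i \<Rightarrow>\<^sub>0 int"
  assumes phi_Nil: "\<phi> [] = 0"
    and phi_append: "u \<noteq> [] \<Longrightarrow> v \<noteq> [] \<Longrightarrow> \<phi> (u @ v) = 0"
    and phi_weight: "\<phi> u \<noteq> 0 \<Longrightarrow> word_wt u = \<mu>"
begin

definition deriv :: "'i free \<Rightarrow> 'i free" where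
  "deriv x = contract_left (\<lambda>u v. \<phi> u) (delta a s x)"

lemma deriv_add: "deriv (x + y) = deriv x + deriv y"
  and deriv_scl: "deriv (scl c x) = scl c (deriv x)"
  and deriv_0: "deriv 0 = 0"
  by (simp_all add: deriv_def delta_eq_lin_ext contract_left_def lin_ext_add lin_ext_scl)

lemma deriv_mon: "deriv (mon w c) = scl c (contract_left (\<lambda>u v. \<phi> u) (delta_word a s w))"
  by (simp add: deriv_def delta_eq_lin_ext contract_left_def lin_ext_scl)

lemma deriv_1: "deriv 1 = 0"
  by (simp add: one_eq_wd_Nil deriv_mon phi_Nil)

text \<open>Applied to the product of two left factors, \<open>\<phi>\<close> retains the terms in which one of them is
  empty. If it is the first one, the other has weight \<open>\<mu>\<close> and has been moved past the right factor of
  the first tensor, which accounts for the twisted counit.\<close>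

lemma contract_left_tmult:
  "contract_left (\<lambda>u v. \<phi> u) (tmult a s t u) =
     contract_left (\<lambda>u v. \<phi> u) t * contract_left (twisted_counit a s 0) u +
     contract_left (twisted_counit a s \<mu>) t * contract_left (\<lambda>u v. \<phi> u) u"
proof (induction t rule: linear_induct)
  case (mon x c)
  obtain x1 x2 where x: "x = (x1, x2)" by (cases x)
  show ?case
  proof (induction u rule: linear_induct)
    case (mon y d)
    obtain y1 y2 where y: "y = (y1, y2)" by (cases y)
    have "\<phi> y1 = 0 \<or> word_wt y1 = \<mu>" using phi_weight by blast
    then show ?case
      by (cases "x1 = []"; cases "y1 = []")
        (auto simp: x y tmult_mon mon_mult_mon twisted_counit_def phi_Nil phi_append,
          simp_all add: algebra_simps)
  qed (simp_all add: tmult_add_right contract_left_add algebra_simps)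
qed (simp_all add: tmult_add_left contract_left_add algebra_simps)

text \<open>The coproduct is defined letter by letter, so the twisted derivation rule is first read off for
  a single letter in front of a word.\<close>

lemma deriv_word_append:
  "positive_word (x @ y) \<Longrightarrow>
   deriv (wd (x @ y)) = deriv (wd x) * wd y + scl (twist a s (word_wt x) \<mu>) (wd x * deriv (wd y))"
proof (induction x)
  case Nil
  then show ?case by (simp add: deriv_1 flip: one_eq_wd_Nil)
next
  case (Cons g x)
  have pos: "positive_word [g]" "positive_word x" "positive_word (x @ y)"
    using Cons.prems by (auto simp: positive_word_def)
  have letter: "contract_left (twisted_counit a s \<mu>) (delta_gen a s g) =
      mon [g] (twist a s (word_wt [g]) \<mu>)"
    using twisted_counit_delta_word[OF pos(1), of a s \<mu>]
    by (simp add: twisted_counit_tmult twisted_counit_def flip: one_eq_wd_Nil)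
  define dg where "dg = contract_left (\<lambda>u v. \<phi> u) (delta_gen a s g)"
  have step: "deriv (wd (g # w)) = dg * wd w + scl (twist a s (word_wt [g]) \<mu>) (wd [g] * deriv (wd w))"
    if w: "positive_word w" for w
  proof -
    have "mon [g] (twist a s (word_wt [g]) \<mu>) = scl (twist a s (word_wt [g]) \<mu>) (wd [g])" by simp
    then show ?thesis
      by (simp only: deriv_mon scl_1 delta_word.simps contract_left_tmult letter dg_def
          twisted_counit_delta_word[OF w] twist_0 scl_mult_left)
  qed
  have g: "word_wt (g # x) = word_wt [g] + word_wt x" by (cases g) simp
  have "deriv (wd ((g # x) @ y)) =
      dg * (wd x * wd y) + scl (twist a s (word_wt [g]) \<mu>) (wd [g] *
        (deriv (wd x) * wd y + scl (twist a s (word_wt x) \<mu>) (wd x * deriv (wd y))))"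
    using step[OF pos(3)] Cons.IH[OF pos(3)] by (simp add: mon_mult_mon)
  also have "\<dots> = (dg * wd x + scl (twist a s (word_wt [g]) \<mu>) (wd [g] * deriv (wd x))) * wd y +
      scl (twist a s (word_wt (g # x)) \<mu>) ((wd [g] * wd x) * deriv (wd y))"
    unfolding g twist_add_left
    by (simp add: distrib_left distrib_right scl_add scl_mult_left scl_mult_right mult.assoc)
  finally show ?case
    using step[OF pos(2)] by (simp add: mon_mult_mon)
qed

lemma deriv_mult:
  assumes "homogeneous \<kappa> x" "\<forall>w\<in>supp x. positive_word w" "\<forall>w\<in>supp y. positive_word w"
  shows "deriv (x * y) = deriv x * y + scl (twist a s \<kappa> \<mu>) (x * deriv y)"
proof -
  have word: "deriv (mon u c * y) = deriv (mon u c) * y + scl (twist a s \<kappa> \<mu>) (mon u c * deriv y)"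
    if u: "u \<in> supp x" for u c
  proof -
    have pos: "positive_word u" and wt: "word_wt u = \<kappa>"
      using assms u by (auto simp: homogeneous_def)
    have "deriv (mon u c * z) = deriv (mon u c) * z + scl (twist a s \<kappa> \<mu>) (mon u c * deriv z)"
      if z: "z = (\<Sum>v\<in>V. mon v (cf y v))" and V: "V \<subseteq> supp y" and fin: "finite V" for V z
      using fin V unfolding z
    proof (induction V)
      case (insert v V)
      have "positive_word v"
        using insert.prems assms(3) by auto
      then have "positive_word (u @ v)" using pos by (auto simp: positive_word_def)
      then have wds: "deriv (wd u * wd v) = deriv (wd u) * wd v + scl (twist a s \<kappa> \<mu>) (wd u * deriv (wd v))"
        by (simp add: deriv_word_append mon_mult_mon wt)
      have "deriv (scl c (wd u) * scl d (wd v)) = deriv (scl c (wd u)) * scl d (wd v) +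
          scl (twist a s \<kappa> \<mu>) (scl c (wd u) * deriv (scl d (wd v)))" for d
        by (simp only: scl_mult_left scl_mult_right deriv_scl wds scl_add scl_scl mult_ac)
      then have "deriv (mon u c * mon v d) =
         deriv (mon u c) * mon v d + scl (twist a s \<kappa> \<mu>) (mon u c * deriv (mon v d))" for d
        by simp
      then show ?case
        using insert by (simp add: distrib_left deriv_add scl_add)
    qed (simp add: deriv_0)
    from this[of y "supp y"] show ?thesis by (simp add: sum_mon_supp)
  qed
  have "deriv (z * y) = deriv z * y + scl (twist a s \<kappa> \<mu>) (z * deriv y)"
    if z: "z = (\<Sum>u\<in>V. mon u (cf x u))" and V: "V \<subseteq> supp x" and fin: "finite V" for V z
    using fin V unfolding z
    by (induction V) (simp_all add: deriv_0 distrib_right deriv_add scl_add word)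
  from this[of x "supp x"] show ?thesis by (simp add: sum_mon_supp)
qed

end

section \<open>Lusztig's form and its radical\<close>

lemma words_in_0 [simp]: "0 \<in> words_in G"
  and words_in_1 [simp]: "1 \<in> words_in G"
  and words_in_mon: "set w \<subseteq> G \<Longrightarrow> mon w c \<in> words_in G"
  and words_in_add: "x \<in> words_in G \<Longrightarrow> y \<in> words_in G \<Longrightarrow> x + y \<in> words_in G"
  and words_in_uminus: "x \<in> words_in G \<Longrightarrow> - x \<in> words_in G"
  and words_in_scl: "x \<in> words_in G \<Longrightarrow> scl c x \<in> words_in G"
  using keys_add[of x y] supp_scl[of c x]
  by (auto simp: words_in_def one_eq_wd_Nil dest!: subsetD)

lemma words_in_sum: "(\<And>k. k \<in> A \<Longrightarrow> f k \<in> words_in G) \<Longrightarrow> sum f A \<in> words_in G"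
  by (induction A rule: infinite_finite_induct) (auto intro: words_in_add)

lemma words_in_diff: "x \<in> words_in G \<Longrightarrow> y \<in> words_in G \<Longrightarrow> x - y \<in> words_in G"
  using words_in_add[OF _ words_in_uminus, of x G y] by simp

lemma words_in_mult:
  assumes "x \<in> words_in G" "y \<in> words_in G"
  shows "x * y \<in> words_in G"
proof -
  have "set w \<subseteq> G" if w: "w \<in> supp (x * y)" for w
  proof -
    obtain u v where "w = u @ v" "u \<in> supp x" "v \<in> supp y"
      using subsetD[OF keys_mult w] by (auto simp: plus_list_def)
    then show ?thesis using assms by (auto simp: words_in_def)
  qed
  then show ?thesis by (simp add: words_in_def)
qed

lemma words_in_mono: "x \<in> words_in G \<Longrightarrow> G \<subseteq> H \<Longrightarrow> x \<in> words_in H"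
  by (auto simp: words_in_def)

lemma words_in_contract_left:
  assumes "letters_closed G" "x \<in> words_in G"
  shows "contract_left \<chi> (delta a s x) \<in> words_in G"
proof -
  have "set w \<subseteq> G" if w: "w \<in> supp (contract_left \<chi> (delta a s x))" for w
  proof -
    obtain p where "p \<in> supp (delta a s x)" "w \<in> supp (case p of (u, v) \<Rightarrow> mon v (\<chi> u v))"
      using subsetD[OF supp_lin_ext w[unfolded contract_left_def]] by blast
    then show ?thesis
      using supp_delta[OF assms, of "fst p" "snd p"] by (cases p) (auto split: if_splits)
  qed
  then show ?thesis by (simp add: words_in_def)
qed

lemma ring_free_alg: "ring (free_alg a)"
  unfolding free_alg_def
  by (rule ringI, rule abelian_groupI)
    (auto simp: words_in_add words_in_mult algebra_simps
      intro!: monoidI bexI[OF _ words_in_uminus])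

locale lusztig_algebra =
  fixes a :: "'i \<Rightarrow> 'i \<Rightarrow> int" and s :: "'i \<Rightarrow> int" and \<nu> :: "'i \<times> nat \<Rightarrow> ratfun"
    and L :: "'i free \<Rightarrow> 'i free \<Rightarrow> ratfun"
  assumes datum: "borcherds_cartan a s" and lusztig: "lusztig_form a s \<nu> L"
begin

abbreviation "F \<equiv> words_in (Iinf a)"
abbreviation "R \<equiv> form_radical a L"
abbreviation "U \<equiv> Uminus a L"
abbreviation "cls \<equiv> Ucls a L"
abbreviation "uscl \<equiv> Uscl a L"

lemma carrier_free_alg [simp]: "carrier (free_alg a) = F"
  by (simp add: free_alg_def)

lemma letters_closed_Iinf: "letters_closed (Iinf a)"
  by (auto simp: letters_closed_def Iinf_def)

lemma positive_word_Iinf: "set w \<subseteq> Iinf a \<Longrightarrow> positive_word w"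
  by (fastforce simp: positive_word_def Iinf_def)

lemma supp_F: "x \<in> F \<Longrightarrow> w \<in> supp x \<Longrightarrow> set w \<subseteq> Iinf a"
  by (auto simp: words_in_def)

lemma L_add_left: "x \<in> F \<Longrightarrow> x' \<in> F \<Longrightarrow> y \<in> F \<Longrightarrow> L (x + x') y = L x y + L x' y"
  and L_scl_left: "x \<in> F \<Longrightarrow> y \<in> F \<Longrightarrow> L (scl c x) y = c * L x y"
  and L_sym: "x \<in> F \<Longrightarrow> y \<in> F \<Longrightarrow> L x y = L y x"
  and L_1_1: "L 1 1 = 1"
  and L_orthogonal: "x \<in> F \<Longrightarrow> y \<in> F \<Longrightarrow> homogeneous \<mu> x \<Longrightarrow> homogeneous \<mu>' y \<Longrightarrow> \<mu> \<noteq> \<mu>' \<Longrightarrow> L x y = 0"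
  and L_mult: "x \<in> F \<Longrightarrow> y \<in> F \<Longrightarrow> z \<in> F \<Longrightarrow> L x (y * z) = tens_form L (delta a s x) y z"
  using lusztig unfolding lusztig_form_def Let_def carrier_free_alg by blast+

lemma L_add_right: "x \<in> F \<Longrightarrow> y \<in> F \<Longrightarrow> y' \<in> F \<Longrightarrow> L x (y + y') = L x y + L x y'"
  by (metis L_add_left L_sym words_in_add)

lemma L_scl_right: "x \<in> F \<Longrightarrow> y \<in> F \<Longrightarrow> L x (scl c y) = c * L x y"
  by (metis L_scl_left L_sym words_in_scl)

lemma L_0_left [simp]: "y \<in> F \<Longrightarrow> L 0 y = 0"
  using L_scl_left[of 0 y 0] by simp

lemma L_diff_left: "x \<in> F \<Longrightarrow> x' \<in> F \<Longrightarrow> y \<in> F \<Longrightarrow> L (x - x') y = L x y - L x' y"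
  using L_add_left[of "x - x'" x' y] by (simp add: words_in_diff)

lemma L_sum_left:
  "(\<And>k. k \<in> A \<Longrightarrow> f k \<in> F) \<Longrightarrow> y \<in> F \<Longrightarrow> L (sum f A) y = (\<Sum>k\<in>A. L (f k) y)"
  by (induction A rule: infinite_finite_induct) (simp_all add: L_add_left words_in_sum)

lemma L_sum_right:
  assumes "\<And>k. k \<in> A \<Longrightarrow> f k \<in> F" "x \<in> F"
  shows "L x (sum f A) = (\<Sum>k\<in>A. L x (f k))"
  using assms(1)
proof (induction A rule: infinite_finite_induct)
  case (infinite A)
  then show ?case using L_scl_right[OF assms(2) words_in_0, of 0] by simp
next
  case empty
  then show ?case using L_scl_right[OF assms(2) words_in_0, of 0] by simp
qed (simp add: assms(2) L_add_right words_in_sum)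

lemma L_expand_left:
  assumes "x \<in> F" "y \<in> F"
  shows "L x y = (\<Sum>w\<in>supp x. cf x w * L (wd w) y)"
proof -
  have "L (\<Sum>w\<in>supp x. scl (cf x w) (wd w)) y = (\<Sum>w\<in>supp x. cf x w * L (wd w) y)"
    using assms supp_F[OF assms(1)]
    by (subst L_sum_left) (auto simp: L_scl_left words_in_mon words_in_scl simp del: scl_mon)
  then show ?thesis by (simp add: sum_mon_supp)
qed

lemma L_expand_right:
  assumes "x \<in> F" "y \<in> F"
  shows "L x y = (\<Sum>w\<in>supp y. cf y w * L x (wd w))"
proof -
  have "L x y = (\<Sum>w\<in>supp y. cf y w * L (wd w) x)"
    using L_sym[OF assms] L_expand_left[OF assms(2,1)] by (rule trans)
  also have "\<dots> = (\<Sum>w\<in>supp y. cf y w * L x (wd w))"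
  proof (rule sum.cong[OF refl])
    fix w assume "w \<in> supp y"
    then show "cf y w * L (wd w) x = cf y w * L x (wd w)"
      using L_sym[OF assms(1) words_in_mon[OF supp_F[OF assms(2)]], of w 1] by simp
  qed
  finally show ?thesis .
qed

lemma L_word_eq_0: "set w \<subseteq> Iinf a \<Longrightarrow> y \<in> F \<Longrightarrow> homogeneous \<mu> y \<Longrightarrow> word_wt w \<noteq> \<mu> \<Longrightarrow> L (wd w) y = 0"
  by (rule L_orthogonal[of _ _ "word_wt w" \<mu>]) (simp_all add: words_in_mon)

text \<open>Only pairings between the two factors of \<open>\<delta> x\<close> and \<open>y\<close>, \<open>z\<close> enter \<open>L x (y * z)\<close>. If \<open>x\<close>
  is a combination of words over a set of letters closed under the coproduct, so are these factors.\<close>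

lemma L_mult_eq_0:
  assumes G: "letters_closed G" "G \<subseteq> Iinf a" and x: "x \<in> words_in G" and yz: "y \<in> F" "z \<in> F"
    and zero: "\<And>u v. set u \<subseteq> G \<Longrightarrow> set v \<subseteq> G \<Longrightarrow> L (wd u) y = 0 \<or> L (wd v) z = 0"
  shows "L x (y * z) = 0"
proof -
  have "x \<in> F" using x G(2) by (rule words_in_mono)
  then have "L x (y * z) = tens_form L (delta a s x) y z" using yz by (rule L_mult)
  also have "\<dots> = 0"
    unfolding tens_form_def using zero supp_delta[OF G(1) x] by (fastforce intro: sum.neutral)
  finally show ?thesis .
qed

lemma mem_R_iff: "x \<in> R \<longleftrightarrow> x \<in> F \<and> (\<forall>w. set w \<subseteq> Iinf a \<longrightarrow> L x (wd w) = 0)"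
proof
  assume R: "x \<in> F \<and> (\<forall>w. set w \<subseteq> Iinf a \<longrightarrow> L x (wd w) = 0)"
  then have "L x y = 0" if "y \<in> F" for y
    using L_expand_right[OF _ that, of x] supp_F[OF that] by (simp add: sum.neutral)
  then show "x \<in> R" using R by (simp add: form_radical_def)
qed (auto simp: form_radical_def words_in_mon)

lemma R_eq_0: "x \<in> R \<Longrightarrow> y \<in> F \<Longrightarrow> L x y = 0" "x \<in> R \<Longrightarrow> x \<in> F"
  by (simp_all add: form_radical_def)

lemma R_mult:
  assumes "x \<in> R" "y \<in> F"
  shows "x * y \<in> R" "y * x \<in> R"
proof -
  have *: "L (wd w) x = 0" if "set w \<subseteq> Iinf a" for w
    using that R_eq_0(1)[OF assms(1) words_in_mon[OF that]] R_eq_0(2)[OF assms(1)]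
    by (metis L_sym words_in_mon)
  have "L z (x * y) = 0" "L z (y * x) = 0" if "z \<in> F" for z
    by (rule L_mult_eq_0[OF letters_closed_Iinf subset_refl that];
        use * R_eq_0(2) assms in simp)+
  then show "x * y \<in> R" "y * x \<in> R"
    using assms R_eq_0(2)[OF assms(1)] L_sym[OF words_in_mult]
    by (simp_all add: form_radical_def words_in_mult)
qed

lemma ideal_R: "ideal R (free_alg a)"
proof (rule idealI)
  interpret ring "free_alg a" by (rule ring_free_alg)
  show "ring (free_alg a)" by (rule ring_free_alg)
  have neg: "\<ominus>\<^bsub>free_alg a\<^esub> x = - x" if "x \<in> F" for x
    using that by (intro minus_equality) (auto simp: words_in_uminus, simp_all add: free_alg_def)
  show "subgroup R (add_monoid (free_alg a))"
  proof (rule add.subgroupI)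
    show "R \<subseteq> carrier (free_alg a)" "R \<noteq> {}"
      by (auto simp: form_radical_def intro!: exI[of _ 0])
    fix x assume x: "x \<in> R"
    have "L (- x) y = - L x y" if "y \<in> F" for y
      using L_scl_left[OF R_eq_0(2)[OF x] that, of "- 1"] by (simp add: scl_uminus_1)
    then show "\<ominus>\<^bsub>free_alg a\<^esub> x \<in> R"
      using x neg[OF R_eq_0(2)[OF x]] by (simp add: form_radical_def words_in_uminus)
    fix y assume "y \<in> R"
    then have "x + y \<in> R" using x by (simp add: form_radical_def L_add_left words_in_add)
    then show "x \<oplus>\<^bsub>free_alg a\<^esub> y \<in> R" by (simp add: free_alg_def)
  qed
qed (simp_all add: R_mult, simp_all add: free_alg_def R_mult)

lemma ring_U: "ring U"
  unfolding Uminus_def by (rule ideal.quotient_is_ring[OF ideal_R])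

lemma cls_hom: "ring_hom_ring (free_alg a) U cls"
proof -
  have "cls = (+>\<^bsub>free_alg a\<^esub>) R" by (rule ext) (simp add: Ucls_def)
  then show ?thesis unfolding Uminus_def using ideal.rcos_ring_hom_ring[OF ideal_R] by simp
qed

lemma cls_mem: "x \<in> F \<Longrightarrow> cls x \<in> carrier U"
  and cls_add: "x \<in> F \<Longrightarrow> y \<in> F \<Longrightarrow> cls (x + y) = cls x \<oplus>\<^bsub>U\<^esub> cls y"
  and cls_mult: "x \<in> F \<Longrightarrow> y \<in> F \<Longrightarrow> cls (x * y) = cls x \<otimes>\<^bsub>U\<^esub> cls y"
  and cls_1: "cls 1 = \<one>\<^bsub>U\<^esub>"
  and cls_0: "cls 0 = \<zero>\<^bsub>U\<^esub>"
proof -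
  interpret ring_hom_ring "free_alg a" U cls by (rule cls_hom)
  show "x \<in> F \<Longrightarrow> cls x \<in> carrier U" using hom_closed by simp
  show "x \<in> F \<Longrightarrow> y \<in> F \<Longrightarrow> cls (x + y) = cls x \<oplus>\<^bsub>U\<^esub> cls y"
    using hom_add[of x y] by (simp add: free_alg_def)
  show "x \<in> F \<Longrightarrow> y \<in> F \<Longrightarrow> cls (x * y) = cls x \<otimes>\<^bsub>U\<^esub> cls y"
    using hom_mult[of x y] by (simp add: free_alg_def)
  show "cls 1 = \<one>\<^bsub>U\<^esub>" using hom_one by (simp add: free_alg_def)
  show "cls 0 = \<zero>\<^bsub>U\<^esub>" using hom_zero by (simp add: free_alg_def)
qed

lemma carrier_U_E:
  assumes "X \<in> carrier U" obtains x where "x \<in> F" "X = cls x"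
  using assms that by (auto simp: Uminus_def FactRing_def A_RCOSETS_def' Ucls_def)

lemma mem_cls: "y \<in> cls x \<longleftrightarrow> (\<exists>r\<in>R. y = r + x)"
  by (auto simp: Ucls_def a_r_coset_def' free_alg_def)

lemma cls_eqI:
  assumes "x \<in> F" "y \<in> F" "x - y \<in> R"
  shows "cls x = cls y"
proof -
  interpret abelian_subgroup R "free_alg a"
    by (rule abelian_subgroupI3)
      (use ideal_R ring_free_alg in \<open>auto simp: ideal_def ring_def\<close>)
  have "x \<in> cls y" using assms(3) by (auto simp: mem_cls intro!: bexI[of _ "x - y"])
  then show ?thesis
    using a_repr_independence'[of x y] assms by (simp add: Ucls_def)
qed

lemma uscl_cls: "x \<in> F \<Longrightarrow> uscl c (cls x) = cls (scl c x)"
  by (simp add: Uscl_def words_in_scl scl_mult_left flip: cls_mult)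

lemma uscl_mem: "X \<in> carrier U \<Longrightarrow> uscl c X \<in> carrier U"
  by (metis carrier_U_E cls_mem uscl_cls words_in_scl)

lemma Lform_cls:
  assumes "x \<in> F" "y \<in> F"
  shows "Lform L (cls x) (cls y) = L x y"
proof -
  have val: "L x' y' = L x y" if xy: "x' \<in> cls x" "y' \<in> cls y" for x' y'
  proof -
    obtain r r' where r: "r \<in> R" "x' = r + x" "r' \<in> R" "y' = r' + y"
      using xy by (auto simp: mem_cls)
    then have F: "r \<in> F" "r' \<in> F" using R_eq_0(2) by auto
    have "L x' y' = L x (r' + y)"
      using r F assms by (simp add: L_add_left R_eq_0 words_in_add)
    also have "\<dots> = L r' x + L x y"
      using F(2) assms L_sym[OF F(2) assms(1)] by (simp only: L_add_right)
    finally show ?thesis using r assms by (simp add: R_eq_0)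
  qed
  have "0 \<in> R" by (simp add: form_radical_def)
  then have "x \<in> cls x" "y \<in> cls y" by (auto simp: mem_cls intro!: bexI[of _ 0])
  then show ?thesis unfolding Lform_def using val by (intro the_equality) blast+
qed

lemma Lform_add_left:
  assumes "X \<in> carrier U" "X' \<in> carrier U" "Y \<in> carrier U"
  shows "Lform L (X \<oplus>\<^bsub>U\<^esub> X') Y = Lform L X Y + Lform L X' Y"
proof -
  obtain x x' y where "x \<in> F" "x' \<in> F" "y \<in> F" "X = cls x" "X' = cls x'" "Y = cls y"
    using assms by (metis carrier_U_E)
  then show ?thesis by (simp add: Lform_cls L_add_left words_in_add flip: cls_add)
qed

lemma Lform_uscl_left:
  assumes "X \<in> carrier U" "Y \<in> carrier U"
  shows "Lform L (uscl c X) Y = c * Lform L X Y"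
proof -
  obtain x y where "x \<in> F" "y \<in> F" "X = cls x" "Y = cls y"
    using assms by (metis carrier_U_E)
  then show ?thesis by (simp add: Lform_cls L_scl_left words_in_scl uscl_cls)
qed

lemma Lform_sym: "X \<in> carrier U \<Longrightarrow> Y \<in> carrier U \<Longrightarrow> Lform L X Y = Lform L Y X"
  by (metis carrier_U_E Lform_cls L_sym)

end

section \<open>Homogeneous representatives of the primitive generators\<close>

definition weight_part :: "('i \<Rightarrow>\<^sub>0 int) \<Rightarrow> 'i free \<Rightarrow> 'i free" where
  "weight_part \<mu> = lin_ext (\<lambda>w. if word_wt w = \<mu> then wd w else 0)"

lemma lookup_weight_part: "cf (weight_part \<mu> x) w = (if word_wt w = \<mu> then cf x w else 0)"
  unfolding weight_part_def
  by (induction x rule: linear_induct) (auto simp: lin_ext_add lookup_add lookup_single when_def)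

lemma supp_weight_part: "supp (weight_part \<mu> x) = {w \<in> supp x. word_wt w = \<mu>}"
  by (auto simp: in_keys_iff lookup_weight_part split: if_splits)

lemma homogeneous_weight_part: "homogeneous \<mu> (weight_part \<mu> x)"
  by (simp add: homogeneous_def supp_weight_part)

lemma words_in_weight_part: "x \<in> words_in G \<Longrightarrow> weight_part \<mu> x \<in> words_in G"
  by (simp add: words_in_def supp_weight_part)

abbreviation lower_letters :: "'i \<Rightarrow> nat \<Rightarrow> ('i \<times> nat) set" where
  "lower_letters i l \<equiv> {(i, k) | k. 0 < k \<and> k < l}"

lemma letters_closed_lower: "letters_closed (lower_letters i l)"
  by (auto simp: letters_closed_def)

context lusztig_algebra
begin

lemma L_weight_part:
  assumes "x \<in> F" "set w \<subseteq> Iinf a"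
  shows "L (weight_part \<mu> x) (wd w) = (if word_wt w = \<mu> then L x (wd w) else 0)"
proof -
  have zero: "L (wd u) (wd w) = 0" if "u \<in> supp x" "word_wt u \<noteq> word_wt w" for u
    using assms supp_F[OF assms(1) that(1)] that(2) L_word_eq_0[of u "wd w" "word_wt w"]
    by (simp_all add: words_in_mon)
  have "L (weight_part \<mu> x) (wd w) = (\<Sum>u\<in>{u \<in> supp x. word_wt u = \<mu>}. cf x u * L (wd u) (wd w))"
    using assms by (subst L_expand_left) (auto simp: words_in_weight_part words_in_mon
        supp_weight_part lookup_weight_part intro: sum.cong)
  also have "\<dots> = (if word_wt w = \<mu> then \<Sum>u\<in>supp x. cf x u * L (wd u) (wd w) else 0)"
    by (auto intro!: sum.neutral sum.mono_neutral_left) (use zero in metis)+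
  also have "(\<Sum>u\<in>supp x. cf x u * L (wd u) (wd w)) = L x (wd w)"
    using assms by (subst L_expand_left[of x]) (auto simp: words_in_mon)
  finally show ?thesis .
qed

text \<open>The elements \<open>h k\<close> are triangular modifications of the letters \<open>(i, k)\<close>, so a word in the letters
  of index \<open>i\<close> can be rewritten with \<open>h N\<close> in place of its largest letters \<open>(i, N)\<close>, one after the
  other. For \<open>N \<ge> l\<close> a product with a factor \<open>h N\<close> pairs to zero with \<open>q\<close>: the coproduct maps the
  subalgebra on the lower letters into its tensor square, and \<open>h N\<close> is orthogonal to this
  subalgebra. What remains are words in the lower letters, to which \<open>q\<close> is orthogonal. Words with
  other indices have other weights.\<close>

lemma lower_orthogonal_imp_radical:
  assumes i: "i \<in> Iim a" and q: "q \<in> words_in (lower_letters i l)"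
    and orth: "\<And>w. set w \<subseteq> lower_letters i l \<Longrightarrow> L q (wd w) = 0"
    and h_lower: "\<And>k. 0 < k \<Longrightarrow> fgen i k - h k \<in> words_in (lower_letters i k)"
    and h_orth: "\<And>k w. 0 < k \<Longrightarrow> set w \<subseteq> lower_letters i k \<Longrightarrow> L (wd w) (h k) = 0"
    and l: "0 < l"
  shows "q \<in> R"
proof -
  have sub: "lower_letters i k \<subseteq> Iinf a" for k using i by (auto simp: Iinf_def)
  have qF: "q \<in> F" using q sub by (rule words_in_mono)
  have hF: "h k \<in> F" if "0 < k" for k
  proof -
    have "fgen i k \<in> F" using i that by (auto simp: fgen_def gen_word_def Iinf_def intro: words_in_mon)
    then have "fgen i k - (fgen i k - h k) \<in> F"
      using words_in_mono[OF h_lower[OF that] sub] by (rule words_in_diff)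
    then show ?thesis by simp
  qed
  have product: "L q (y * (h k * z)) = 0" if "l \<le> k" "y \<in> F" "z \<in> F" for k y z
  proof (rule L_mult_eq_0[OF letters_closed_lower sub q that(2)])
    have k: "0 < k" using that(1) l by simp
    show "h k * z \<in> F" using hF[OF k] that(3) by (rule words_in_mult)
    fix u v assume v: "set v \<subseteq> lower_letters i l"
    have "L (wd v) (h k * z) = 0"
    proof (rule L_mult_eq_0[OF letters_closed_lower sub words_in_mon[OF v] hF[OF k] that(3)])
      fix u' v' assume "set u' \<subseteq> lower_letters i l"
      then have "set u' \<subseteq> lower_letters i k" using that(1) by auto
      then show "L (wd u') (h k) = 0 \<or> L (wd v') z = 0" using h_orth[OF k] by blast
    qed
    then show "L (wd u) y = 0 \<or> L (wd v) (h k * z) = 0" ..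
  qed
  have letters_i: "L q (wd w) = 0" if "l \<le> N" "set w \<subseteq> lower_letters i N" for N w
    using that
  proof (induction N arbitrary: w rule: dec_induct)
    case base
    then show ?case by (rule orth)
  next
    case (step N)
    have N: "0 < N" using step.hyps l by simp
    show ?case
      using step.prems
    proof (induction "count_list w (i, N)" arbitrary: w rule: less_induct)
      case less
      show ?case
      proof (cases "(i, N) \<in> set w")
        case False
        then have "set w \<subseteq> lower_letters i N"
          using less.prems by (fastforce simp: less_Suc_eq)
        then show ?thesis by (rule step.IH)
      next
        case True
        then obtain y z where w: "w = y @ (i, N) # z" by (meson split_list)
        have yz: "wd y \<in> F" "wd z \<in> F"
          using less.prems sub by (fastforce simp: w intro: words_in_mon)+
        define p where "p = fgen i N - h N"
        have p: "p \<in> words_in (lower_letters i N)" unfolding p_def using N by (rule h_lower)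
        then have pF: "p \<in> F" using sub by (rule words_in_mono)
        have "L q (wd y * (mon v c * wd z)) = 0" if v: "v \<in> supp p" for v c
        proof -
          have v_lower: "set v \<subseteq> lower_letters i N" using p v by (auto simp: words_in_def)
          then have "(i, N) \<notin> set v" by auto
          then have "count_list (y @ v @ z) (i, N) < count_list w (i, N)"
            by (simp add: w)
          moreover have "set (y @ v @ z) \<subseteq> lower_letters i (Suc N)"
            using less.prems v_lower by (fastforce simp: w)
          ultimately have "L q (wd (y @ v @ z)) = 0" by (rule less.hyps)
          moreover have "wd y * (mon v c * wd z) = scl c (wd (y @ v @ z))"
            by (simp add: mon_mult_mon)
          moreover have "wd (y @ v @ z) \<in> F"
            using \<open>set (y @ v @ z) \<subseteq> lower_letters i (Suc N)\<close> sub by (intro words_in_mon) blast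
          ultimately show ?thesis using L_scl_right[OF qF, of "wd (y @ v @ z)" c] by simp
        qed
        moreover have "wd y * (p * wd z) = (\<Sum>v\<in>supp p. wd y * (mon v (cf p v) * wd z))"
          by (subst sum_mon_supp[of p, symmetric]) (simp only: sum_distrib_left sum_distrib_right)
        moreover have "L q (\<Sum>v\<in>V. wd y * (mon v (cf p v) * wd z)) =
           (\<Sum>v\<in>V. L q (wd y * (mon v (cf p v) * wd z)))" if "V \<subseteq> supp p" for V
        proof -
          have "wd y * (mon v (cf p v) * wd z) \<in> F" if "v \<in> V" for v
            using supp_F[OF pF, of v] \<open>V \<subseteq> supp p\<close> that
            by (intro words_in_mult[OF yz(1)] words_in_mult[OF _ yz(2)] words_in_mon) auto
          then show ?thesis using qF by (intro L_sum_right)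
        qed
        ultimately have "L q (wd y * (p * wd z)) = 0" by simp
        moreover have "L q (wd y * (h N * wd z)) = 0" using product[OF step.hyps(1) yz] .
        moreover have "wd w = wd y * (h N * wd z) + wd y * (p * wd z)"
        proof -
          have "wd w = wd y * (fgen i N * wd z)"
            using N by (simp add: w fgen_def gen_word_def mon_mult_mon)
          also have "fgen i N = h N + p" by (simp add: p_def)
          finally show ?thesis by (simp add: distrib_left distrib_right)
        qed
        ultimately show ?thesis
          using L_add_right[OF qF, of "wd y * (h N * wd z)" "wd y * (p * wd z)"] yz pF hF[OF N]
          by (simp add: words_in_mult)
      qed
    qed
  qed
  have "L q (wd w) = 0" if w: "set w \<subseteq> Iinf a" for w
  proof (cases "\<forall>g\<in>set w. fst g = i")
    case True
    \<comment> \<open>Any bound above \<open>l\<close> and all degrees in \<open>w\<close> will do.\<close>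
    define N where "N = Suc (l + sum_list (map snd w))"
    have "set w \<subseteq> lower_letters i N"
    proof
      fix g assume g: "g \<in> set w"
      then have "snd g \<le> sum_list (map snd w)" by (intro member_le_sum_list) auto
      moreover have "0 < snd g" using g positive_word_Iinf[OF w] by (simp add: positive_word_def)
      ultimately show "g \<in> lower_letters i N" using g True by (cases g) (auto simp: N_def)
    qed
    then show ?thesis by (intro letters_i[of N]) (simp add: N_def)
  next
    case False
    have "L (wd u) (wd w) = 0" if u: "u \<in> supp q" for u
    proof (rule L_word_eq_0[of _ _ "word_wt w"])
      have "set u \<subseteq> lower_letters i l" using q u by (auto simp: words_in_def)
      then have u_i: "\<forall>g\<in>set u. fst g = i" by auto
      have "word_wt u = mon i (- int (sum_list (map snd u)))"
        using u_i by (induction u) (auto simp: single_add[symmetric])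
      then show "word_wt u \<noteq> word_wt w"
        using False positive_word_of_weight(1)[OF positive_word_Iinf[OF w]] by metis
    qed (use u w supp_F[OF qF] in \<open>auto intro: words_in_mon\<close>)
    then show ?thesis using L_expand_left[OF qF words_in_mon[OF w]] by simp
  qed
  then show ?thesis using qF by (simp add: mem_R_iff)
qed

text \<open>The conditions on \<open>b (i, l)\<close> do not mention weights, and a representative \<open>f\<^sub>i\<^sub>l + p\<close> with \<open>p\<close> in the
  lower letters may be inhomogeneous. Its part of weight \<open>- l \<alpha>\<^sub>i\<close> satisfies the same orthogonality
  relations. The difference of the two is therefore an element in the lower letters that is
  orthogonal to all words in the lower letters, so that it lies in the radical.\<close>

lemma imaginary_representative:
  assumes prim: "primitive_generators a L b" and i: "i \<in> Iim a" and l: "0 < l"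
  obtains B where "B \<in> F" "cls B = b (i, l)" "homogeneous (mon i (- int l)) B"
    "\<And>w. set w \<subseteq> lower_letters i l \<Longrightarrow> L (wd w) B = 0"
proof -
  have sub: "lower_letters i k \<subseteq> Iinf a" for k using i by (auto simp: Iinf_def)
  have fF: "fgen i k \<in> F" if "0 < k" for k
    using i that by (auto simp: fgen_def gen_word_def Iinf_def intro: words_in_mon)
  define tail where "tail k p \<longleftrightarrow> p \<in> words_in (lower_letters i k) \<and> b (i, k) = cls (fgen i k + p) \<and>
      (\<forall>w. set w \<subseteq> lower_letters i k \<longrightarrow> L (fgen i k + p) (wd w) = 0)" for k p
  have "\<exists>p. tail k p" if k: "0 < k" for k
  proof -
    interpret ring U by (rule ring_U)
    have b: "b (i, k) \<in> carrier U" "b (i, k) \<ominus>\<^bsub>U\<^esub> cls (fgen i k) \<in> Usub a L i k"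
      "\<forall>w\<in>Usub a L i k. Lform L (b (i, k)) w = 0"
      using prim i k by (auto simp: primitive_generators_def)
    from b(2) obtain p where p: "p \<in> words_in (lower_letters i k)"
      and bp: "b (i, k) \<ominus>\<^bsub>U\<^esub> cls (fgen i k) = cls p"
      by (auto simp: Usub_def)
    have pF: "p \<in> F" using p sub by (rule words_in_mono)
    have c: "cls (fgen i k) \<in> carrier U" using fF[OF k] by (rule cls_mem)
    have "cls (fgen i k + p) = cls (fgen i k) \<oplus>\<^bsub>U\<^esub> (b (i, k) \<ominus>\<^bsub>U\<^esub> cls (fgen i k))"
      using fF[OF k] pF by (simp add: cls_add bp)
    also have "\<dots> = b (i, k)" using b(1) c by algebra
    finally have eq: "b (i, k) = cls (fgen i k + p)" ..
    have "L (fgen i k + p) (wd w) = 0" if w: "set w \<subseteq> lower_letters i k" for w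
    proof -
      have "cls (wd w) \<in> Usub a L i k" using w by (auto simp: Usub_def intro: words_in_mon)
      then have "Lform L (b (i, k)) (cls (wd w)) = 0" using b(3) by blast
      moreover have "wd w \<in> F" using w sub by (intro words_in_mon) blast
      ultimately show ?thesis
        using fF[OF k] pF by (simp add: eq Lform_cls words_in_add)
    qed
    then show ?thesis using p eq unfolding tail_def by blast
  qed
  then have "\<forall>k. \<exists>p. 0 < k \<longrightarrow> tail k p" by blast
  then obtain p where "\<forall>k. 0 < k \<longrightarrow> tail k (p k)" by (rule choice[THEN exE])
  then have p: "\<And>k. 0 < k \<Longrightarrow> p k \<in> words_in (lower_letters i k)"
    and b: "\<And>k. 0 < k \<Longrightarrow> b (i, k) = cls (fgen i k + p k)"
    and orth: "\<And>k w. 0 < k \<Longrightarrow> set w \<subseteq> lower_letters i k \<Longrightarrow> L (fgen i k + p k) (wd w) = 0"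
    unfolding tail_def by blast+
  define P where "P k = weight_part (mon i (- int k)) (p k)" for k
  define h where "h k = fgen i k + P k" for k
  have P: "P k \<in> words_in (lower_letters i k)" if "0 < k" for k
    unfolding P_def using p[OF that] by (rule words_in_weight_part)
  have pF: "p k \<in> F" and PF: "P k \<in> F" and hF: "h k \<in> F" if "0 < k" for k
    using words_in_mono[OF p[OF that] sub] words_in_mono[OF P[OF that] sub] fF[OF that]
    by (simp_all add: h_def words_in_add)
  have f_hom: "homogeneous (mon i (- int k)) (fgen i k)" if "0 < k" for k
    using that homogeneous_wd[of "gen_word i k" 1] by (simp add: fgen_def gen_word_def)
  have h_hom: "homogeneous (mon i (- int k)) (h k)" if "0 < k" for k
    using f_hom[OF that] homogeneous_weight_part[of "mon i (- int k)" "p k"] keys_add[of "fgen i k" "P k"]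
    unfolding homogeneous_def h_def P_def by blast
  have h_part: "h k = weight_part (mon i (- int k)) (fgen i k + p k)" if "0 < k" for k
    using f_hom[OF that]
    by (intro poly_mapping_eqI)
      (auto simp: h_def P_def lookup_weight_part lookup_add homogeneous_def in_keys_iff)
  have h_orth: "L (wd w) (h k) = 0" if "0 < k" "set w \<subseteq> lower_letters i k" for k w
  proof -
    have w: "set w \<subseteq> Iinf a" using that(2) sub by blast
    have "L (h k) (wd w) = 0"
      using L_weight_part[of "fgen i k + p k" w] orth[OF that] fF[OF that(1)] pF[OF that(1)] w
      by (simp add: h_part that(1) words_in_add)
    then show ?thesis using L_sym[OF hF[OF that(1)] words_in_mon[OF w]] by simp
  qed
  have "p l - P l \<in> R"
  proof (rule lower_orthogonal_imp_radical[OF i _ _ _ h_orth l])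
    show "p l - P l \<in> words_in (lower_letters i l)"
      using p[OF l] P[OF l] by (rule words_in_diff)
    show "fgen i k - h k \<in> words_in (lower_letters i k)" if "0 < k" for k
      using words_in_uminus[OF P[OF that]] by (simp add: h_def)
    show "L (p l - P l) (wd w) = 0" if w: "set w \<subseteq> lower_letters i l" for w
    proof -
      have wF: "wd w \<in> F" using w sub by (intro words_in_mon) blast
      have tails: "p l - P l = (fgen i l + p l) - h l" by (simp add: h_def)
      have "L (p l - P l) (wd w) = L (fgen i l + p l) (wd w) - L (h l) (wd w)"
        unfolding tails by (rule L_diff_left[OF words_in_add[OF fF[OF l] pF[OF l]] hF[OF l] wF])
      then show ?thesis using orth[OF l w] h_orth[OF l w] L_sym[OF hF[OF l] wF] by simp
    qed
  qed
  then have "(fgen i l + p l) - h l \<in> R" by (simp add: h_def)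
  then have "cls (fgen i l + p l) = cls (h l)"
    by (intro cls_eqI) (simp_all only: fF[OF l] pF[OF l] hF[OF l] words_in_add)
  then show ?thesis using that[of "h l"] hF[OF l] h_hom[OF l] h_orth[OF l] b[OF l] by blast
qed

text \<open>A homogeneous element of weight \<open>- l \<alpha>\<^sub>i\<close> pairs with a word only if all letters have
  index \<open>i\<close> and degrees summing to \<open>l\<close>. If there are at least two of them, all are below \<open>(i, l)\<close>,
  where the orthogonality in the definition of the generators applies; for a real index, with
  \<open>l = 1\<close>, there is no such word at all. Vanishing on long words is the form in which
  primitivity is used: it replaces \<open>\<delta> b = b \<otimes> 1 + 1 \<otimes> b\<close>, which holds only modulo the radical.\<close>

lemma primitive_representative:
  assumes prim: "primitive_generators a L b" and g: "g \<in> Iinf a"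
  obtains B where "B \<in> F" "cls B = b g" "homogeneous (word_wt [g]) B"
    "\<And>w. set w \<subseteq> Iinf a \<Longrightarrow> 2 \<le> length w \<Longrightarrow> L (wd w) B = 0"
proof -
  obtain i l where il: "g = (i, l)" by (cases g)
  have "\<exists>B\<in>F. cls B = b (i, l) \<and> homogeneous (mon i (- int l)) B \<and>
    (\<forall>w. set w \<subseteq> lower_letters i l \<longrightarrow> 2 \<le> length w \<longrightarrow> L (wd w) B = 0)"
  proof (cases "i \<in> Ire a")
    case True
    then have l: "l = 1" using g by (auto simp: il Iinf_def Ire_def Iim_def)
    show ?thesis
    proof (intro bexI[of _ "fgen i 1"] conjI allI impI)
      show "cls (fgen i 1) = b (i, l)" using prim True by (simp add: primitive_generators_def l)
      show "homogeneous (mon i (- int l)) (fgen i 1)" by (simp add: homogeneous_def fgen_def gen_word_def l)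
      show "fgen i 1 \<in> F" using g by (auto simp: fgen_def gen_word_def il l intro: words_in_mon)
      fix w :: "'i word" assume w: "set w \<subseteq> lower_letters i l" "2 \<le> length w"
      then have "set w = {}" by (auto simp: l)
      then show "L (wd w) (fgen i 1) = 0" using w(2) by simp
    qed
  next
    case False
    then have "i \<in> Iim a" "0 < l" using g by (auto simp: il Iinf_def)
    from imaginary_representative[OF prim this] show ?thesis by (metis (no_types, lifting))
  qed
  then obtain B where B: "B \<in> F" "cls B = b (i, l)" "homogeneous (mon i (- int l)) B"
    and low: "\<And>w. set w \<subseteq> lower_letters i l \<Longrightarrow> 2 \<le> length w \<Longrightarrow> L (wd w) B = 0"
    by blast
  have "L (wd w) B = 0" if w: "set w \<subseteq> Iinf a" "2 \<le> length w" for w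
  proof (cases "word_wt w = mon i (- int l)")
    case True
    note pos = positive_word_Iinf[OF w(1)]
    have "set w \<subseteq> lower_letters i l"
    proof
      fix h assume h: "h \<in> set w"
      then have "snd h < l" "fst h = i"
        using letter_less_of_long_word[OF pos w(2) h] positive_word_of_weight[OF pos True] by auto
      then show "h \<in> lower_letters i l" using h pos by (cases h) (auto simp: positive_word_def)
    qed
    then show ?thesis using w(2) by (rule low)
  next
    case False
    then show ?thesis using L_word_eq_0[OF w(1) B(1,3)] by simp
  qed
  then show ?thesis using that[of B] B by (simp add: il)
qed

end

section \<open>Kashiwara's operators as adjoints for Lusztig's form\<close>

locale kashiwara_algebra = lusztig_algebra a s \<nu> L
  for a :: "'i \<Rightarrow> 'i \<Rightarrow> int" and s :: "'i \<Rightarrow> int" and \<nu> :: "'i \<times> nat \<Rightarrow> ratfun"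
    and L :: "'i free \<Rightarrow> 'i free \<Rightarrow> ratfun" +
  fixes b :: "'i \<times> nat \<Rightarrow> 'i free set"
    and e' :: "'i \<times> nat \<Rightarrow> 'i free set \<Rightarrow> 'i free set"
    and K :: "'i free set \<Rightarrow> 'i free set \<Rightarrow> ratfun"
    and N :: "'i \<times> nat \<Rightarrow> ratfun"
  assumes primitive: "primitive_generators a L b"
    and norm_b: "g \<in> Iinf a \<Longrightarrow> Lform L (b g) (b g) = N g"
    and N_nonzero: "g \<in> Iinf a \<Longrightarrow> N g \<noteq> 0"
    and derivations: "kashiwara_derivations a s L b e'"
    and kashiwara: "kashiwara_form a L b e' K"
begin

definition rep :: "'i \<times> nat \<Rightarrow> 'i free" where
  "rep g = (SOME B. B \<in> F \<and> cls B = b g \<and> homogeneous (word_wt [g]) B \<and>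
     (\<forall>w. set w \<subseteq> Iinf a \<longrightarrow> 2 \<le> length w \<longrightarrow> L (wd w) B = 0))"

lemma rep:
  assumes "g \<in> Iinf a"
  shows rep_F: "rep g \<in> F" and cls_rep: "cls (rep g) = b g"
    and homogeneous_rep: "homogeneous (word_wt [g]) (rep g)"
    and L_long_rep: "\<And>w. set w \<subseteq> Iinf a \<Longrightarrow> 2 \<le> length w \<Longrightarrow> L (wd w) (rep g) = 0"
proof -
  have "\<exists>B. B \<in> F \<and> cls B = b g \<and> homogeneous (word_wt [g]) B \<and>
     (\<forall>w. set w \<subseteq> Iinf a \<longrightarrow> 2 \<le> length w \<longrightarrow> L (wd w) B = 0)"
    using primitive_representative[OF primitive assms] by metis
  from someI_ex[OF this, folded rep_def]
  show "rep g \<in> F" "cls (rep g) = b g" "homogeneous (word_wt [g]) (rep g)"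
    "\<And>w. set w \<subseteq> Iinf a \<Longrightarrow> 2 \<le> length w \<Longrightarrow> L (wd w) (rep g) = 0"
    by blast+
qed

lemma word_wt_letter_inj:
  assumes "g \<in> Iinf a" "h \<in> Iinf a" "word_wt [g] = word_wt [h]"
  shows "g = h"
proof -
  obtain i l where g: "g = (i, l)" by (cases g)
  have "positive_word [h]" using assms by (intro positive_word_Iinf) simp
  moreover have "word_wt [h] = mon i (- int l)" using assms(3) by (simp add: g)
  ultimately show ?thesis
    using positive_word_of_weight[of "[h]" i l] by (cases h) (simp add: g)
qed

lemma word_wt_letter_nonzero: "g \<in> Iinf a \<Longrightarrow> word_wt [g] \<noteq> 0"
  using positive_word_wt_eq_0[OF positive_word_Iinf, of "[g]"] by auto

lemma L_rep:
  assumes "g \<in> Iinf a" "h \<in> Iinf a"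
  shows "L (rep g) (rep h) = (if g = h then N g else 0)"
proof (cases "g = h")
  case True
  then show ?thesis using norm_b[OF assms(1)] Lform_cls[OF rep_F rep_F] assms
    by (simp add: cls_rep)
next
  case False
  then have "word_wt [g] \<noteq> word_wt [h]" using assms word_wt_letter_inj by blast
  then have "L (rep g) (rep h) = 0"
    using assms by (intro L_orthogonal[OF rep_F rep_F homogeneous_rep homogeneous_rep])
  then show ?thesis using False by simp
qed

text \<open>The value \<open>0\<close> on words with a letter outside \<^term>\<open>Iinf a\<close>, where \<^term>\<open>L\<close> is arbitrary,
  makes the functional primitive on all words.\<close>

definition pair_rep :: "'i \<times> nat \<Rightarrow> 'i word \<Rightarrow> ratfun" where
  "pair_rep g w = (if set w \<subseteq> Iinf a then L (wd w) (rep g) else 0)"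

lemma primitive_pair_rep:
  assumes g: "g \<in> Iinf a"
  shows "primitive_functional (pair_rep g) (word_wt [g])"
proof (rule primitive_functional.intro)
  show wt: "word_wt u = word_wt [g]" if u: "pair_rep g u \<noteq> 0" for u
  proof (rule ccontr)
    assume "word_wt u \<noteq> word_wt [g]"
    then have "set u \<subseteq> Iinf a \<Longrightarrow> L (wd u) (rep g) = 0"
      using L_word_eq_0[OF _ rep_F[OF g] homogeneous_rep[OF g]] by blast
    then show False using u unfolding pair_rep_def by metis
  qed
  show "pair_rep g [] = 0"
    using wt[of "[]"] word_wt_letter_nonzero[OF g] by (metis word_wt_simps(1))
  show "pair_rep g (u @ v) = 0" if "u \<noteq> []" "v \<noteq> []" for u v
  proof -
    have "2 \<le> length (u @ v)" using that by (cases u; cases v) auto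
    then show ?thesis using L_long_rep[OF g] unfolding pair_rep_def by metis
  qed
qed

definition D :: "'i \<times> nat \<Rightarrow> 'i free \<Rightarrow> 'i free" where
  "D g = primitive_functional.deriv a s (pair_rep g)"

lemma D_eq: "g \<in> Iinf a \<Longrightarrow> D g x = contract_left (\<lambda>u v. pair_rep g u) (delta a s x)"
  unfolding D_def by (rule primitive_functional.deriv_def[OF primitive_pair_rep])

lemma D_F: "g \<in> Iinf a \<Longrightarrow> x \<in> F \<Longrightarrow> D g x \<in> F"
  by (simp add: D_eq words_in_contract_left letters_closed_Iinf)

lemma D_1: "g \<in> Iinf a \<Longrightarrow> D g 1 = 0"
  unfolding D_def by (rule primitive_functional.deriv_1[OF primitive_pair_rep])

lemma D_mult:
  assumes "g \<in> Iinf a" "homogeneous \<mu> x" "x \<in> F" "y \<in> F"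
  shows "D g (x * y) = D g x * y + scl (twist a s \<mu> (word_wt [g])) (x * D g y)"
  unfolding D_def
  by (rule primitive_functional.deriv_mult[OF primitive_pair_rep])
    (use assms supp_F positive_word_Iinf in blast)+

text \<open>This is the defining property \<open>(x, y z)\<^sub>L = (\<delta> x, y \<otimes> z)\<^sub>L\<close> with the left tensor factor
  contracted against \<open>rep g\<close>, read through the symmetry of the form.\<close>

lemma L_rep_mult:
  assumes g: "g \<in> Iinf a" and x: "x \<in> F" and y: "y \<in> F"
  shows "L (rep g * y) x = L (D g x) y"
proof -
  let ?d = "delta a s x"
  have uv: "set u \<subseteq> Iinf a" "set v \<subseteq> Iinf a" if "(u, v) \<in> supp ?d" for u v
    using supp_delta[OF letters_closed_Iinf x that] by auto
  have Dg: "D g x = (\<Sum>p\<in>supp ?d. mon (snd p) (cf ?d p * pair_rep g (fst p)))"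
    by (simp add: D_eq[OF g] contract_left_def lin_ext_def case_prod_unfold)
  have "L (D g x) y = (\<Sum>p\<in>supp ?d. L (mon (snd p) (cf ?d p * pair_rep g (fst p))) y)"
    unfolding Dg
  proof (rule L_sum_left[OF words_in_mon y])
    fix p assume "p \<in> supp ?d"
    then show "set (snd p) \<subseteq> Iinf a" using uv(2)[of "fst p" "snd p"] by simp
  qed
  also have "\<dots> = (\<Sum>p\<in>supp ?d. cf ?d p * L (wd (fst p)) (rep g) * L (wd (snd p)) y)"
  proof (rule sum.cong[OF refl])
    fix p assume p: "p \<in> supp ?d"
    let ?c = "cf ?d p * pair_rep g (fst p)"
    have "L (mon (snd p) ?c) y = ?c * L (wd (snd p)) y"
      using L_scl_left[OF words_in_mon[of "snd p" _ 1] y, of ?c] uv[of "fst p" "snd p"] p by simp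
    then show "L (mon (snd p) (cf ?d p * pair_rep g (fst p))) y =
        cf ?d p * L (wd (fst p)) (rep g) * L (wd (snd p)) y"
      using uv[of "fst p" "snd p"] p by (simp add: pair_rep_def)
  qed
  also have "\<dots> = tens_form L ?d (rep g) y"
    by (simp add: tens_form_def case_prod_unfold)
  also have "\<dots> = L x (rep g * y)" by (rule L_mult[OF x rep_F[OF g] y, symmetric])
  also have "\<dots> = L (rep g * y) x" by (rule L_sym[OF x words_in_mult[OF rep_F[OF g] y]])
  finally show ?thesis ..
qed

text \<open>By adjunction, \<open>D g (rep h)\<close> pairs with a word \<open>w\<close> as \<open>rep g * w\<close> does with \<open>rep h\<close>. Every word
  in \<open>rep g * w\<close> has at least two letters unless \<open>w\<close> is empty.\<close>

lemma D_rep: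
  assumes g: "g \<in> Iinf a" and h: "h \<in> Iinf a"
  shows "D g (rep h) - scl (if g = h then N g else 0) 1 \<in> R" (is "_ - scl ?c 1 \<in> R")
proof -
  have F: "D g (rep h) \<in> F" "scl ?c 1 \<in> F" "rep h \<in> F"
    using D_F[OF g rep_F[OF h]] rep_F[OF h] by (simp_all add: words_in_scl)
  have "L (D g (rep h)) (wd w) = ?c * L 1 (wd w)" if w: "set w \<subseteq> Iinf a" for w
  proof (cases "w = []")
    case True
    have "L (D g (rep h)) 1 = L (rep g) (rep h)"
      using L_rep_mult[OF g F(3), of 1] by simp
    then show ?thesis using L_rep[OF g h] L_1_1 by (simp add: True flip: one_eq_wd_Nil)
  next
    case False
    have "L (wd (u @ w)) (rep h) = 0" if u: "u \<in> supp (rep g)" for u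
    proof (rule L_long_rep[OF h])
      have "u \<noteq> []"
        using homogeneous_rep[OF g] u word_wt_letter_nonzero[OF g] by (auto simp: homogeneous_def)
      then show "2 \<le> length (u @ w)" using False by (cases u; cases w) auto
      show "set (u @ w) \<subseteq> Iinf a" using w supp_F[OF rep_F[OF g] u] by simp
    qed
    then have "L (mon u c * wd w) (rep h) = 0" if u: "u \<in> supp (rep g)" for u c
      using L_scl_left[OF words_in_mon F(3), of "u @ w" c 1] w supp_F[OF rep_F[OF g] u] u
      by (simp add: mon_mult_mon)
    moreover have "rep g * wd w = (\<Sum>u\<in>supp (rep g). mon u (cf (rep g) u) * wd w)"
      by (subst sum_mon_supp[of "rep g", symmetric]) (rule sum_distrib_right)
    moreover have "L (\<Sum>u\<in>supp (rep g). mon u (cf (rep g) u) * wd w) (rep h) =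
        (\<Sum>u\<in>supp (rep g). L (mon u (cf (rep g) u) * wd w) (rep h))"
      using w supp_F[OF rep_F[OF g]] F(3)
      by (intro L_sum_left words_in_mult words_in_mon) auto
    ultimately have "L (rep g * wd w) (rep h) = 0" by simp
    then have "L (D g (rep h)) (wd w) = 0"
      using L_rep_mult[OF g F(3) words_in_mon[OF w]] by simp
    moreover have "L 1 (wd w) = 0"
      unfolding one_eq_wd_Nil
      using positive_word_wt_eq_0[OF positive_word_Iinf[OF w]] False w
      by (intro L_word_eq_0[of _ _ "word_wt w"]) (auto intro: words_in_mon)
    ultimately show ?thesis by simp
  qed
  then show ?thesis
    using F by (simp add: mem_R_iff L_diff_left L_scl_left words_in_diff words_in_mon)
qed


section \<open>Products of primitive generators\<close>

abbreviation "bp \<equiv> bprod a L b"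

definition rep_prod :: "'i word \<Rightarrow> 'i free" where
  "rep_prod w = foldr (\<lambda>g x. rep g * x) w 1"

lemma bp_simps: "bp [] = \<one>\<^bsub>U\<^esub>" "bp (g # w) = b g \<otimes>\<^bsub>U\<^esub> bp w"
  by (simp_all add: bprod_def)

lemma rep_prod_F: "set w \<subseteq> Iinf a \<Longrightarrow> rep_prod w \<in> F"
  by (induction w) (auto simp: rep_prod_def intro: words_in_mult rep_F)

lemma cls_rep_prod: "set w \<subseteq> Iinf a \<Longrightarrow> cls (rep_prod w) = bp w"
proof (induction w)
  case (Cons g w)
  then show ?case
    using cls_mult[OF rep_F rep_prod_F, of g w]
    by (simp add: bp_simps cls_rep) (simp add: rep_prod_def)
qed (simp add: rep_prod_def bp_simps cls_1)

lemma bp_mem: "set w \<subseteq> Iinf a \<Longrightarrow> bp w \<in> carrier U"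
  using cls_mem[OF rep_prod_F] cls_rep_prod by metis

lemma b_mem: "g \<in> Iinf a \<Longrightarrow> b g \<in> carrier U"
  using cls_mem[OF rep_F] cls_rep by metis

lemma e'_1: "g \<in> Iinf a \<Longrightarrow> e' g \<one>\<^bsub>U\<^esub> = \<zero>\<^bsub>U\<^esub>"
  using derivations by (cases g) (auto simp: kashiwara_derivations_def Let_def)

text \<open>The factor in Kashiwara's rule is the twist of the two weights, as
  \<open>(\<alpha>\<^sub>j, \<alpha>\<^sub>i) = s\<^sub>j a\<^sub>j\<^sub>i = s\<^sub>i a\<^sub>i\<^sub>j\<close>.\<close>

lemma e'_b_mult:
  assumes "g \<in> Iinf a" "h \<in> Iinf a" "X \<in> carrier U"
  shows "e' g (b h \<otimes>\<^bsub>U\<^esub> X) = (if g = h then X else \<zero>\<^bsub>U\<^esub>) \<oplus>\<^bsub>U\<^esub>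
    uscl (twist a s (word_wt [h]) (word_wt [g])) (b h \<otimes>\<^bsub>U\<^esub> e' g X)"
proof -
  obtain i l j k where gh: "g = (i, l)" "h = (j, k)" by (cases g; cases h)
  have "s j * a j i = s i * a i j" using datum by (simp add: borcherds_cartan_def)
  then have "twist a s (word_wt [h]) (word_wt [g]) = qv powi (s i * (- (int k * int l * a i j)))"
    by (simp add: twist_def gh root_form_single mult_ac)
  moreover have "e' (i, l) (b (j, k) \<otimes>\<^bsub>U\<^esub> X) = (if i = j \<and> l = k then X else \<zero>\<^bsub>U\<^esub>) \<oplus>\<^bsub>U\<^esub>
      uscl (qv powi (s i * (- (int k * int l * a i j)))) (b (j, k) \<otimes>\<^bsub>U\<^esub> e' (i, l) X)"
  proof -
    note rules = bspec[OF derivations[unfolded kashiwara_derivations_def Let_def] assms(1)[unfolded gh],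
        unfolded prod.case]
    show ?thesis
      using bspec[OF bspec[OF rules[THEN conjunct2, THEN conjunct2, THEN conjunct2, THEN conjunct2]
            assms(2)[unfolded gh], unfolded prod.case] assms(3)] .
  qed
  ultimately show ?thesis by (simp add: gh)
qed

text \<open>Modulo the radical, \<open>D g\<close> divided by \<open>N g\<close> obeys Kashiwara's recursion, by the derivation rule
  and the values of \<open>D g\<close> on the generators.\<close>

lemma e'_bp:
  assumes g: "g \<in> Iinf a"
  shows "set w \<subseteq> Iinf a \<Longrightarrow> e' g (bp w) = cls (scl (inverse (N g)) (D g (rep_prod w)))"
proof (induction w)
  case Nil
  then show ?case using g by (simp add: bp_simps e'_1 rep_prod_def D_1 cls_0)
next
  case (Cons h w)
  then have h: "h \<in> Iinf a" and w: "set w \<subseteq> Iinf a" by auto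
  let ?t = "twist a s (word_wt [h]) (word_wt [g])"
  let ?n = "inverse (N g)"
  let ?c = "if g = h then 1 else 0 :: ratfun"
  let ?d = "if g = h then N g else 0"
  let ?p = "rep_prod w"
  note F = rep_F[OF h] rep_prod_F[OF w] D_F[OF g rep_prod_F[OF w]] D_F[OF g rep_F[OF h]]
  have "e' g (bp (h # w)) = (if g = h then bp w else \<zero>\<^bsub>U\<^esub>) \<oplus>\<^bsub>U\<^esub> uscl ?t (b h \<otimes>\<^bsub>U\<^esub> e' g (bp w))"
    using e'_b_mult[OF g h bp_mem[OF w]] by (simp add: bp_simps)
  also have "(if g = h then bp w else \<zero>\<^bsub>U\<^esub>) = cls (scl ?c ?p)"
    by (simp add: cls_rep_prod[OF w] cls_0)
  also have "uscl ?t (b h \<otimes>\<^bsub>U\<^esub> e' g (bp w)) = cls (scl ?t (rep h * scl ?n (D g ?p)))"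
    using F by (simp add: Cons.IH[OF w] cls_rep[OF h, symmetric] uscl_cls words_in_mult
        words_in_scl flip: cls_mult)
  also have "cls (scl ?c ?p) \<oplus>\<^bsub>U\<^esub> cls (scl ?t (rep h * scl ?n (D g ?p))) =
      cls (scl ?c ?p + scl ?t (rep h * scl ?n (D g ?p)))"
    using F by (intro cls_add[symmetric] words_in_scl words_in_mult) auto
  also have "\<dots> = cls (scl ?n (D g (rep_prod (h # w))))"
  proof (rule cls_eqI[symmetric])
    have split: "D g (rep_prod (h # w)) = D g (rep h) * ?p + scl ?t (rep h * D g ?p)"
      using D_mult[OF g homogeneous_rep[OF h] F(1,2)] by (simp add: rep_prod_def)
    have "scl ?n (D g (rep_prod (h # w))) - (scl ?c ?p + scl ?t (rep h * scl ?n (D g ?p))) =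
        scl ?n (D g (rep h) * ?p) - scl ?c ?p"
      unfolding split by (simp add: scl_add scl_mult_right mult_ac)
    also have "\<dots> = scl ?n (D g (rep h) * ?p) - scl ?n (scl ?d 1 * ?p)"
      using N_nonzero[OF g] by (auto simp: scl_mult_left)
    also have "\<dots> = (D g (rep h) - scl ?d 1) * scl ?n ?p"
      by (simp add: left_diff_distrib scl_mult_right scl_diff)
    also have "\<dots> \<in> R" using F by (intro R_mult(1)[OF D_rep[OF g h]] words_in_scl)
    finally show "scl ?n (D g (rep_prod (h # w))) - (scl ?c ?p + scl ?t (rep h * scl ?n (D g ?p))) \<in> R" .
    show "scl ?n (D g (rep_prod (h # w))) \<in> F"
      using Cons.prems by (intro words_in_scl D_F[OF g] rep_prod_F)
    show "scl ?c ?p + scl ?t (rep h * scl ?n (D g ?p)) \<in> F"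
      using F by (intro words_in_add words_in_scl words_in_mult)
  qed
  finally show ?case .
qed

text \<open>This is the rule that defines Kashiwara's form, up to the factor \<^term>\<open>N g\<close> by which
  \<^term>\<open>D g\<close> differs from Kashiwara's operator.\<close>

lemma Lform_b_mult:
  assumes g: "g \<in> Iinf a" and X: "X \<in> carrier U" and w: "set w \<subseteq> Iinf a"
  shows "Lform L (b g \<otimes>\<^bsub>U\<^esub> X) (bp w) = N g * Lform L X (e' g (bp w))"
proof -
  obtain x where x: "x \<in> F" "X = cls x" using X by (rule carrier_U_E)
  let ?p = "rep_prod w"
  have p: "?p \<in> F" "D g ?p \<in> F" using rep_prod_F[OF w] D_F[OF g] by auto
  have "Lform L (b g \<otimes>\<^bsub>U\<^esub> X) (bp w) = L (rep g * x) ?p"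
    using x rep_F[OF g] p
    by (simp add: cls_rep[OF g, symmetric] cls_rep_prod[OF w, symmetric] Lform_cls words_in_mult
        flip: cls_mult)
  also have "\<dots> = L (D g ?p) x" using g p(1) x(1) by (rule L_rep_mult)
  also have "\<dots> = N g * L (scl (inverse (N g)) (D g ?p)) x"
    using N_nonzero[OF g] x p by (simp add: L_scl_left)
  also have "\<dots> = N g * L x (scl (inverse (N g)) (D g ?p))"
    using L_sym[OF words_in_scl[OF p(2)] x(1)] by simp
  finally show ?thesis using x p by (simp add: e'_bp[OF g w] Lform_cls words_in_scl)
qed


text \<open>The spaces \<^term>\<open>Ucomp a L b \<beta>\<close> as closures, for inductions over their elements.\<close>

inductive_set bspan :: "('i \<times> nat) multiset \<Rightarrow> 'i free set set" for \<beta> where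
  zero: "\<zero>\<^bsub>U\<^esub> \<in> bspan \<beta>"
| word: "mset w = \<beta> \<Longrightarrow> bp w \<in> bspan \<beta>"
| add: "X \<in> bspan \<beta> \<Longrightarrow> Y \<in> bspan \<beta> \<Longrightarrow> X \<oplus>\<^bsub>U\<^esub> Y \<in> bspan \<beta>"
| scale: "X \<in> bspan \<beta> \<Longrightarrow> uscl c X \<in> bspan \<beta>"

lemma bspan_mem:
  assumes "X \<in> bspan \<beta>" "set_mset \<beta> \<subseteq> Iinf a"
  shows "X \<in> carrier U"
proof -
  interpret ring U by (rule ring_U)
  show ?thesis
    using assms by induction (auto intro: bp_mem uscl_mem)
qed

lemma mult_uscl:
  assumes "X \<in> carrier U" "Y \<in> carrier U"
  shows "X \<otimes>\<^bsub>U\<^esub> uscl c Y = uscl c (X \<otimes>\<^bsub>U\<^esub> Y)"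
proof -
  obtain x y where "x \<in> F" "y \<in> F" "X = cls x" "Y = cls y"
    using assms by (metis carrier_U_E)
  then show ?thesis
    by (simp add: uscl_cls words_in_scl words_in_mult scl_mult_right flip: cls_mult)
qed

lemma b_mult_bspan:
  assumes X: "X \<in> bspan \<beta>" and \<beta>: "set_mset \<beta> \<subseteq> Iinf a" and h: "h \<in> Iinf a"
  shows "b h \<otimes>\<^bsub>U\<^esub> X \<in> bspan (add_mset h \<beta>)"
proof -
  interpret ring U by (rule ring_U)
  note b = b_mem[OF h]
  show ?thesis
    using X
  proof induction
    case zero
    then show ?case using b by (simp add: bspan.zero)
  next
    case (word w)
    then have "bp (h # w) \<in> bspan (add_mset h \<beta>)" by (intro bspan.word) simp
    then show ?case by (simp add: bp_simps)
  next
    case (add X Y)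
    then show ?case using b bspan_mem[OF _ \<beta>] by (simp add: r_distr bspan.add)
  next
    case (scale X c)
    then show ?case using b bspan_mem[OF _ \<beta>] by (simp add: mult_uscl bspan.scale)
  qed
qed

lemma e'_bp_bspan:
  assumes g: "g \<in> Iinf a" and w: "set w \<subseteq> Iinf a"
  shows "e' g (bp w) \<in> bspan (mset w - {#g#})" and "g \<notin> set w \<Longrightarrow> e' g (bp w) = \<zero>\<^bsub>U\<^esub>"
proof -
  interpret ring U by (rule ring_U)
  have uscl_0: "uscl c \<zero>\<^bsub>U\<^esub> = \<zero>\<^bsub>U\<^esub>" for c
    using uscl_cls[of 0 c] by (simp add: cls_0)
  have "e' g (bp w) \<in> bspan (mset w - {#g#}) \<and> (g \<notin> set w \<longrightarrow> e' g (bp w) = \<zero>\<^bsub>U\<^esub>)"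
    using w
  proof (induction w)
    case Nil
    then show ?case using e'_1[OF g] by (simp add: bp_simps bspan.zero)
  next
    case (Cons h w)
    then have h: "h \<in> Iinf a" and w: "set w \<subseteq> Iinf a"
      and IH: "e' g (bp w) \<in> bspan (mset w - {#g#})" "g \<notin> set w \<Longrightarrow> e' g (bp w) = \<zero>\<^bsub>U\<^esub>"
      by auto
    let ?t = "twist a s (word_wt [h]) (word_wt [g])"
    have eq: "e' g (bp (h # w)) = (if g = h then bp w else \<zero>\<^bsub>U\<^esub>) \<oplus>\<^bsub>U\<^esub> uscl ?t (b h \<otimes>\<^bsub>U\<^esub> e' g (bp w))"
      using e'_b_mult[OF g h bp_mem[OF w]] by (simp add: bp_simps)
    have fst: "(if g = h then bp w else \<zero>\<^bsub>U\<^esub>) \<in> bspan (mset (h # w) - {#g#})"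
      by (auto intro: bspan.intros)
    show ?case
    proof (cases "g \<in> set w")
      case True
      then have "add_mset h (mset w - {#g#}) = mset (h # w) - {#g#}" by simp
      moreover have "set_mset (mset w - {#g#}) \<subseteq> Iinf a" using w in_diffD[of _ "mset w" "{#g#}"] by fastforce
      ultimately have "b h \<otimes>\<^bsub>U\<^esub> e' g (bp w) \<in> bspan (mset (h # w) - {#g#})"
        using b_mult_bspan[OF IH(1) _ h] by simp
      then have "e' g (bp (h # w)) \<in> bspan (mset (h # w) - {#g#})"
        unfolding eq using fst by (intro bspan.add bspan.scale)
      then show ?thesis using True by simp
    next
      case False
      then have "e' g (bp (h # w)) = (if g = h then bp w else \<zero>\<^bsub>U\<^esub>)"
        unfolding eq using IH(2) b_mem[OF h] bp_mem[OF w] by (simp add: uscl_0)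
      then show ?thesis using fst by simp
    qed
  qed
  then show "e' g (bp w) \<in> bspan (mset w - {#g#})" "g \<notin> set w \<Longrightarrow> e' g (bp w) = \<zero>\<^bsub>U\<^esub>"
    by blast+
qed


section \<open>The two forms differ by a scalar on each component\<close>

lemma K_add_left: "X \<in> carrier U \<Longrightarrow> X' \<in> carrier U \<Longrightarrow> Y \<in> carrier U \<Longrightarrow>
    K (X \<oplus>\<^bsub>U\<^esub> X') Y = K X Y + K X' Y"
  and K_uscl_left: "X \<in> carrier U \<Longrightarrow> Y \<in> carrier U \<Longrightarrow> K (uscl c X) Y = c * K X Y"
  and K_sym: "X \<in> carrier U \<Longrightarrow> Y \<in> carrier U \<Longrightarrow> K X Y = K Y X"
  and K_1_1: "K \<one>\<^bsub>U\<^esub> \<one>\<^bsub>U\<^esub> = 1"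
  and K_b_mult: "g \<in> Iinf a \<Longrightarrow> X \<in> carrier U \<Longrightarrow> Y \<in> carrier U \<Longrightarrow> K (b g \<otimes>\<^bsub>U\<^esub> X) Y = K X (e' g Y)"
proof -
  note rules = kashiwara[unfolded kashiwara_form_def Let_def]
  show "X \<in> carrier U \<Longrightarrow> X' \<in> carrier U \<Longrightarrow> Y \<in> carrier U \<Longrightarrow>
      K (X \<oplus>\<^bsub>U\<^esub> X') Y = K X Y + K X' Y"
    by (rule rules[THEN conjunct1, rule_format])
  note rules = rules[THEN conjunct2]
  show "X \<in> carrier U \<Longrightarrow> Y \<in> carrier U \<Longrightarrow> K (uscl c X) Y = c * K X Y"
    by (rule rules[THEN conjunct1, rule_format])
  note rules = rules[THEN conjunct2]
  show "X \<in> carrier U \<Longrightarrow> Y \<in> carrier U \<Longrightarrow> K X Y = K Y X"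
    by (rule rules[THEN conjunct1, rule_format])
  note rules = rules[THEN conjunct2, THEN conjunct2]
  show "K \<one>\<^bsub>U\<^esub> \<one>\<^bsub>U\<^esub> = 1" by (rule rules[THEN conjunct1])
  show "g \<in> Iinf a \<Longrightarrow> X \<in> carrier U \<Longrightarrow> Y \<in> carrier U \<Longrightarrow>
      K (b g \<otimes>\<^bsub>U\<^esub> X) Y = K X (e' g Y)"
    by (rule rules[THEN conjunct2, rule_format])
qed

lemma forms_0:
  assumes "X \<in> carrier U"
  shows "K \<zero>\<^bsub>U\<^esub> X = 0" "K X \<zero>\<^bsub>U\<^esub> = 0" "Lform L \<zero>\<^bsub>U\<^esub> X = 0" "Lform L X \<zero>\<^bsub>U\<^esub> = 0"
proof -
  interpret ring U by (rule ring_U)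
  show "K \<zero>\<^bsub>U\<^esub> X = 0" "Lform L \<zero>\<^bsub>U\<^esub> X = 0"
    using K_add_left[of "\<zero>\<^bsub>U\<^esub>" "\<zero>\<^bsub>U\<^esub>" X] Lform_add_left[of "\<zero>\<^bsub>U\<^esub>" "\<zero>\<^bsub>U\<^esub>" X] assms
    by simp_all
  then show "K X \<zero>\<^bsub>U\<^esub> = 0" "Lform L X \<zero>\<^bsub>U\<^esub> = 0"
    using K_sym[OF assms zero_closed] Lform_sym[OF assms zero_closed] by simp_all
qed

text \<open>Proportionality and vanishing extend linearly from products of generators to their spans. Both
  are treated at once, with \<open>ortho\<close> standing for the condition under which Kashiwara's form vanishes.\<close>

lemma forms_bspan_left:
  assumes "X \<in> bspan \<beta>" "set_mset \<beta> \<subseteq> Iinf a" "Y \<in> carrier U"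
    and "\<And>w. mset w = \<beta> \<Longrightarrow> Lform L (bp w) Y = c * K (bp w) Y \<and> (ortho \<longrightarrow> K (bp w) Y = 0)"
  shows "Lform L X Y = c * K X Y \<and> (ortho \<longrightarrow> K X Y = 0)"
proof -
  show ?thesis
    using assms(1)
  proof induction
    case (add X X')
    then show ?case
      using bspan_mem[OF _ assms(2)] assms(3)
      by (simp add: K_add_left Lform_add_left distrib_left)
  next
    case (scale X d)
    then show ?case
      using bspan_mem[OF _ assms(2)] assms(3)
      by (simp add: K_uscl_left Lform_uscl_left)
  qed (use forms_0[OF assms(3)] assms(4) in auto)
qed

lemma forms_bspan_right:
  assumes "Y \<in> bspan \<beta>" "set_mset \<beta> \<subseteq> Iinf a" "X \<in> carrier U"
    and "\<And>w. mset w = \<beta> \<Longrightarrow> Lform L X (bp w) = c * K X (bp w) \<and> (ortho \<longrightarrow> K X (bp w) = 0)"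
  shows "Lform L X Y = c * K X Y \<and> (ortho \<longrightarrow> K X Y = 0)"
proof -
  have bp: "bp w \<in> carrier U" if "mset w = \<beta>" for w
    using assms(2) that by (intro bp_mem) auto
  have "Lform L Y X = c * K Y X \<and> (ortho \<longrightarrow> K Y X = 0)"
  proof (rule forms_bspan_left[OF assms(1,2,3)])
    fix w assume w: "mset w = \<beta>"
    show "Lform L (bp w) X = c * K (bp w) X \<and> (ortho \<longrightarrow> K (bp w) X = 0)"
      unfolding K_sym[OF bp[OF w] assms(3)] Lform_sym[OF bp[OF w] assms(3)] by (rule assms(4)[OF w])
  qed
  then show ?thesis
    unfolding K_sym[OF bspan_mem[OF assms(1,2)] assms(3)] Lform_sym[OF bspan_mem[OF assms(1,2)] assms(3)] .
qed

text \<open>Moving the letters of \<open>w\<close> one after the other to the right argument multiplies Lusztig's form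
  by \<^term>\<open>N g\<close> for each letter \<open>g\<close>, and leaves Kashiwara's form unchanged. Both forms vanish if at
  some stage the right argument does not contain the letter that is moved, or if letters are left
  over on the right.\<close>

lemma compare_products:
  "set w \<subseteq> Iinf a \<Longrightarrow> set w' \<subseteq> Iinf a \<Longrightarrow>
   Lform L (bp w) (bp w') = prod_mset (image_mset N (mset w)) * K (bp w) (bp w') \<and>
   (mset w \<noteq> mset w' \<longrightarrow> K (bp w) (bp w') = 0)"
proof (induction w arbitrary: w')
  case Nil
  interpret ring U by (rule ring_U)
  show ?case
  proof (cases w')
    case Nil
    then show ?thesis
      using K_1_1 Lform_cls[of 1 1] L_1_1 by (simp add: bp_simps cls_1)
  next
    case (Cons h v)
    then have h: "h \<in> Iinf a" and v: "bp v \<in> carrier U" using Nil.prems by (auto intro: bp_mem)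
    have bv: "b h \<otimes>\<^bsub>U\<^esub> bp v \<in> carrier U" using b_mem[OF h] v by simp
    have "K (bp []) (bp w') = K (bp v) \<zero>\<^bsub>U\<^esub>"
      using K_sym[OF one_closed bv] K_b_mult[OF h v one_closed] e'_1[OF h]
      by (simp add: bp_simps Cons)
    also have "\<dots> = 0" using v by (rule forms_0)
    finally have K: "K (bp []) (bp w') = 0" .
    have "Lform L (bp []) (bp w') = N h * Lform L (bp v) \<zero>\<^bsub>U\<^esub>"
      using Lform_sym[OF one_closed bv] Lform_b_mult[OF h v, of "[]"] e'_1[OF h]
      by (simp add: bp_simps Cons)
    also have "\<dots> = 0" using forms_0(4)[OF v] by simp
    finally show ?thesis using K by simp
  qed
next
  case (Cons g w)
  then have g: "g \<in> Iinf a" and w: "set w \<subseteq> Iinf a" and w': "set w' \<subseteq> Iinf a" by auto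
  have diff: "set_mset (mset w' - {#g#}) \<subseteq> Iinf a" using w' in_diffD[of _ "mset w'" "{#g#}"] by fastforce
  have K: "K (bp (g # w)) (bp w') = K (bp w) (e' g (bp w'))"
    using K_b_mult[OF g bp_mem[OF w] bp_mem[OF w']] by (simp add: bp_simps)
  have L: "Lform L (bp (g # w)) (bp w') = N g * Lform L (bp w) (e' g (bp w'))"
    using Lform_b_mult[OF g bp_mem[OF w] w'] by (simp add: bp_simps)
  have compare: "Lform L (bp w) (e' g (bp w')) =
      prod_mset (image_mset N (mset w)) * K (bp w) (e' g (bp w')) \<and>
      (mset w \<noteq> mset w' - {#g#} \<longrightarrow> K (bp w) (e' g (bp w')) = 0)"
  proof (rule forms_bspan_right[OF e'_bp_bspan(1)[OF g w'] diff bp_mem[OF w]])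
    fix v assume v: "mset v = mset w' - {#g#}"
    then have "set v \<subseteq> Iinf a" using diff by (metis set_mset_mset)
    from Cons.IH[OF w this] show "Lform L (bp w) (bp v) =
      prod_mset (image_mset N (mset w)) * K (bp w) (bp v) \<and>
      (mset w \<noteq> mset w' - {#g#} \<longrightarrow> K (bp w) (bp v) = 0)"
      unfolding v .
  qed
  have "K (bp (g # w)) (bp w') = 0" if neq: "mset (g # w) \<noteq> mset w'"
  proof (cases "g \<in> set w'")
    case True
    then have "mset w' = add_mset g (mset w' - {#g#})" by simp
    then have "mset w \<noteq> mset w' - {#g#}" using neq by (metis mset.simps(2))
    then show ?thesis using compare K by simp
  next
    case False
    show ?thesis unfolding K e'_bp_bspan(2)[OF g w' False] by (rule forms_0(2)[OF bp_mem[OF w]])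
  qed
  then show ?case using compare K L by simp
qed

lemma compare_bspan:
  assumes \<beta>: "X \<in> bspan \<beta>" "set_mset \<beta> \<subseteq> Iinf a" and \<gamma>: "Y \<in> bspan \<gamma>" "set_mset \<gamma> \<subseteq> Iinf a"
  shows "Lform L X Y = prod_mset (image_mset N \<beta>) * K X Y" and "\<beta> \<noteq> \<gamma> \<Longrightarrow> K X Y = 0"
proof -
  have "Lform L X Y = prod_mset (image_mset N \<beta>) * K X Y \<and> (\<beta> \<noteq> \<gamma> \<longrightarrow> K X Y = 0)"
  proof (rule forms_bspan_left[OF \<beta> bspan_mem[OF \<gamma>]])
    fix w assume w: "mset w = \<beta>"
    have set_w: "set w \<subseteq> Iinf a" using \<beta>(2) w by auto
    show "Lform L (bp w) Y = prod_mset (image_mset N \<beta>) * K (bp w) Y \<and>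
        (\<beta> \<noteq> \<gamma> \<longrightarrow> K (bp w) Y = 0)"
    proof (rule forms_bspan_right[OF \<gamma> bp_mem[OF set_w]])
      fix v assume v: "mset v = \<gamma>"
      then have "set v \<subseteq> Iinf a" using \<gamma>(2) by auto
      from compare_products[OF set_w this] show "Lform L (bp w) (bp v) =
          prod_mset (image_mset N \<beta>) * K (bp w) (bp v) \<and> (\<beta> \<noteq> \<gamma> \<longrightarrow> K (bp w) (bp v) = 0)"
        unfolding w v .
    qed
  qed
  then show "Lform L X Y = prod_mset (image_mset N \<beta>) * K X Y" "\<beta> \<noteq> \<gamma> \<Longrightarrow> K X Y = 0"
    by blast+
qed

lemma Ucomp_bspan:
  assumes "X \<in> Ucomp a L b \<beta>" "set_mset \<beta> \<subseteq> Iinf a"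
  shows "X \<in> bspan \<beta>"
proof -
  interpret ring U by (rule ring_U)
  obtain c where X: "X = (\<Oplus>\<^bsub>U\<^esub>w\<in>{w. mset w = \<beta>}. uscl (c w) (bp w))"
    using assms(1) by (auto simp: Ucomp_def)
  have "(\<Oplus>\<^bsub>U\<^esub>w\<in>W. uscl (c w) (bp w)) \<in> bspan \<beta>" if "finite W" "W \<subseteq> {w. mset w = \<beta>}" for W
    using that
  proof (induction W)
    case empty
    then show ?case by (simp add: bspan.zero)
  next
    case (insert w W)
    have mem: "uscl (c v) (bp v) \<in> bspan \<beta>" if v: "v \<in> insert w W" for v
    proof -
      have "mset v = \<beta>" using v insert.prems by auto
      then show ?thesis by (intro bspan.scale bspan.word)
    qed
    have carrier: "uscl (c v) (bp v) \<in> carrier U" if "v \<in> insert w W" for v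
      using bspan_mem[OF mem[OF that] assms(2)] .
    have "(\<Oplus>\<^bsub>U\<^esub>w\<in>insert w W. uscl (c w) (bp w)) =
        uscl (c w) (bp w) \<oplus>\<^bsub>U\<^esub> (\<Oplus>\<^bsub>U\<^esub>w\<in>W. uscl (c w) (bp w))"
      using insert.hyps carrier by (intro finsum_insert) auto
    moreover have "(\<Oplus>\<^bsub>U\<^esub>w\<in>W. uscl (c w) (bp w)) \<in> bspan \<beta>" using insert by blast
    ultimately show ?case using mem[of w] by (simp add: bspan.add)
  qed
  moreover have "finite {w. mset w = \<beta>}"
  proof (rule finite_subset)
    show "{w. mset w = \<beta>} \<subseteq> {w. set w \<subseteq> set_mset \<beta> \<and> length w = size \<beta>}" by auto
  qed (rule finite_lists_length_eq, simp)
  ultimately show ?thesis unfolding X by simp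
qed

end

section \<open>Arithmetic modulo \<open>q\<close>\<close>

lemma A0_iff: "z \<in> A0 \<longleftrightarrow> (\<exists>p r. z = Fraction_Field.Fract p r \<and> poly r 0 \<noteq> 0)"
  by (auto simp: A0_def)

lemma A0_add: "x \<in> A0 \<Longrightarrow> y \<in> A0 \<Longrightarrow> x + y \<in> A0"
  and A0_mult: "x \<in> A0 \<Longrightarrow> y \<in> A0 \<Longrightarrow> x * y \<in> A0"
proof -
  assume "x \<in> A0" "y \<in> A0"
  then obtain p r p' r' where *: "x = Fraction_Field.Fract p r" "poly r 0 \<noteq> 0" "y = Fraction_Field.Fract p' r'" "poly r' 0 \<noteq> 0"
    by (auto simp: A0_iff)
  then have nz: "r \<noteq> 0" "r' \<noteq> 0" by auto
  have "x + y = Fraction_Field.Fract (p * r' + p' * r) (r * r')" using * nz by simp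
  moreover have "poly (r * r') 0 \<noteq> 0" using * by simp
  ultimately show "x + y \<in> A0" unfolding A0_iff by blast
  have "x * y = Fraction_Field.Fract (p * p') (r * r')" using * by simp
  with \<open>poly (r * r') 0 \<noteq> 0\<close> show "x * y \<in> A0" unfolding A0_iff by blast
qed

lemma A0_0: "0 \<in> A0" and A0_1: "1 \<in> A0" and qv_A0: "qv \<in> A0"
proof -
  have "Fraction_Field.Fract p 1 \<in> A0" for p :: "rat poly" unfolding A0_iff by (intro exI[of _ p] exI[of _ 1]) simp
  from this[of 0] this[of 1] this[of "[:0, 1:]"] show "0 \<in> A0" "1 \<in> A0" "qv \<in> A0"
    by (simp_all add: qv_def fract_collapse)
qed

lemma qA0_subset: "z \<in> qA0 \<Longrightarrow> z \<in> A0"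
  by (auto simp: qA0_def intro: A0_mult qv_A0)

lemma qA0_add: "x \<in> qA0 \<Longrightarrow> y \<in> qA0 \<Longrightarrow> x + y \<in> qA0"
  unfolding qA0_def by (auto simp: distrib_left[symmetric] intro!: imageI A0_add)

lemma qA0_mult: "x \<in> qA0 \<Longrightarrow> y \<in> A0 \<Longrightarrow> x * y \<in> qA0"
  unfolding qA0_def by (auto simp: mult.assoc intro!: imageI A0_mult)

lemma qA0_0: "0 \<in> qA0"
  using A0_0 by (auto simp: qA0_def image_iff)

lemma qA0_sum: "(\<And>k. k \<in> S \<Longrightarrow> f k \<in> qA0) \<Longrightarrow> sum f S \<in> qA0"
  by (induction S rule: infinite_finite_induct) (auto intro: qA0_0 qA0_add)

lemma prod_mset_one_mod_qA0:
  "(\<And>g. g \<in># M \<Longrightarrow> f g - 1 \<in> qA0) \<Longrightarrow> prod_mset (image_mset f M) - 1 \<in> qA0"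
proof (induction M)
  case (add g M)
  let ?P = "prod_mset (image_mset f M)"
  have P: "?P - 1 \<in> qA0" and g: "f g - 1 \<in> qA0" using add by auto
  have "?P = (?P - 1) + 1" by simp
  then have "?P \<in> A0" using A0_add[OF qA0_subset[OF P] A0_1] by simp
  with g have "(f g - 1) * ?P + (?P - 1) \<in> qA0" using P by (intro qA0_add qA0_mult)
  moreover have "prod_mset (image_mset f (add_mset g M)) - 1 = (f g - 1) * ?P + (?P - 1)"
    by (simp add: algebra_simps)
  ultimately show ?case by (simp only:)
qed (simp add: qA0_0)

lemma inverse_one_minus_qv_power:
  assumes "0 < n"
  shows "1 - qv ^ n \<noteq> 0" "inverse (1 - qv ^ n) - 1 \<in> qA0"
proof -
  have "qv ^ m = Fraction_Field.Fract ([:0, 1:] ^ m) 1" for m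
    by (induction m) (simp_all add: qv_def One_fract_def)
  then have eq: "1 - qv ^ n = Fraction_Field.Fract (1 - [:0, 1:] ^ n) 1"
    by (simp add: One_fract_def)
  have poly: "poly (1 - [:0, 1:] ^ n :: rat poly) 0 = 1" using assms by simp
  show nz: "1 - qv ^ n \<noteq> 0"
  proof
    assume "1 - qv ^ n = 0"
    then have "1 - [:0, 1:] ^ n = (0 :: rat poly)" by (simp add: eq Zero_fract_def eq_fract)
    then show False using poly by simp
  qed
  have "inverse (1 - qv ^ n) \<in> A0"
    unfolding eq inverse_fract A0_iff using poly by (metis zero_neq_one)
  moreover have "qv ^ m \<in> A0" for m
    by (induction m) (auto intro: A0_mult A0_1 qv_A0)
  moreover have "inverse (1 - qv ^ n) - 1 = qv * (qv ^ (n - 1) * inverse (1 - qv ^ n))"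
    using nz assms by (simp add: field_simps flip: power_Suc)
  ultimately show "inverse (1 - qv ^ n) - 1 \<in> qA0"
    unfolding qA0_def by (auto intro: A0_mult)
qed

lemma finsum_additive:
  assumes "ring R" "finite S" "X ` S \<subseteq> carrier R"
    and add: "\<And>x y. x \<in> carrier R \<Longrightarrow> y \<in> carrier R \<Longrightarrow> f (x \<oplus>\<^bsub>R\<^esub> y) = f x + (f y :: 'b :: ab_group_add)"
  shows "f (\<Oplus>\<^bsub>R\<^esub>k\<in>S. X k) = (\<Sum>k\<in>S. f (X k))"
proof -
  interpret ring R by fact
  have zero: "f \<zero>\<^bsub>R\<^esub> = 0" using add[of "\<zero>\<^bsub>R\<^esub>" "\<zero>\<^bsub>R\<^esub>"] by simp
  show ?thesis
    using assms(2,3)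
  proof (induction S)
    case (insert k S)
    then have X: "X k \<in> carrier R" "X \<in> S \<rightarrow> carrier R" by auto
    then have "f (\<Oplus>\<^bsub>R\<^esub>k\<in>insert k S. X k) = f (X k) + f (\<Oplus>\<^bsub>R\<^esub>k\<in>S. X k)"
      using insert.hyps by (simp add: add)
    then show ?case using insert by simp
  qed (simp add: zero)
qed


section \<open>Comparison of the two forms\<close>

context kashiwara_algebra
begin

text \<open>Only the diagonal terms contribute to the double sum over the components, and each of them is
  an integral value of \<^term>\<open>K\<close> times \<open>c - 1\<close>, where \<open>c\<close> is the proportionality factor of the component.\<close>

lemma forms_congruent:
  assumes N: "\<And>g. g \<in> Iinf a \<Longrightarrow> N g - 1 \<in> qA0" and xy: "integrally_paired a L b K x y"
  shows "Lform L x y - K x y \<in> qA0"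
proof -
  obtain S X Y where S: "finite S" and \<beta>: "\<And>\<beta>. \<beta> \<in> S \<Longrightarrow> set_mset \<beta> \<subseteq> Iinf a"
    and X: "\<And>\<beta>. \<beta> \<in> S \<Longrightarrow> X \<beta> \<in> bspan \<beta>" and Y: "\<And>\<beta>. \<beta> \<in> S \<Longrightarrow> Y \<beta> \<in> bspan \<beta>"
    and int: "\<And>\<beta>. \<beta> \<in> S \<Longrightarrow> K (X \<beta>) (Y \<beta>) \<in> A0"
    and sums: "x = (\<Oplus>\<^bsub>U\<^esub>\<beta>\<in>S. X \<beta>)" "y = (\<Oplus>\<^bsub>U\<^esub>\<beta>\<in>S. Y \<beta>)"
  proof -
    obtain S X Y where S: "finite S" "x = (\<Oplus>\<^bsub>U\<^esub>\<beta>\<in>S. X \<beta>)" "y = (\<Oplus>\<^bsub>U\<^esub>\<beta>\<in>S. Y \<beta>)"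
      and comp: "\<forall>\<beta>\<in>S. set_mset \<beta> \<subseteq> Iinf a \<and> X \<beta> \<in> Ucomp a L b \<beta> \<and> Y \<beta> \<in> Ucomp a L b \<beta> \<and>
        K (X \<beta>) (Y \<beta>) \<in> A0"
      using xy unfolding integrally_paired_def by blast
    show ?thesis using comp Ucomp_bspan by (intro that[OF S(1) _ _ _ _ S(2,3)]) blast+
  qed
  interpret ring U by (rule ring_U)
  have XU: "X ` S \<subseteq> carrier U" and YU: "Y ` S \<subseteq> carrier U"
    using bspan_mem X Y \<beta> by blast+
  have yU: "y \<in> carrier U" unfolding sums using YU by (intro finsum_closed) blast
  define f where "f X Y = Lform L X Y - K X Y" for X Y
  have f_sym: "f V W = f W V" if "V \<in> carrier U" "W \<in> carrier U" for V W
    using that K_sym[of V W] Lform_sym[of V W] by (simp add: f_def)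
  have f_add: "f (V \<oplus>\<^bsub>U\<^esub> V') W = f V W + f V' W"
    if "V \<in> carrier U" "V' \<in> carrier U" "W \<in> carrier U" for V V' W
    using that by (simp add: f_def K_add_left Lform_add_left)
  have "f x y = (\<Sum>\<beta>\<in>S. f (X \<beta>) y)"
    unfolding sums(1) using finsum_additive[OF ring_U S XU, of "\<lambda>V. f V y"] f_add yU by simp
  also have "\<dots> = (\<Sum>\<beta>\<in>S. f y (X \<beta>))"
    using f_sym[OF _ yU] XU by (intro sum.cong) auto
  also have "\<dots> = (\<Sum>\<beta>\<in>S. \<Sum>\<gamma>\<in>S. f (Y \<gamma>) (X \<beta>))"
  proof (rule sum.cong[OF refl])
    fix \<beta> assume "\<beta> \<in> S"
    then have "X \<beta> \<in> carrier U" using XU by blast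
    then show "f y (X \<beta>) = (\<Sum>\<gamma>\<in>S. f (Y \<gamma>) (X \<beta>))"
      unfolding sums(2) using finsum_additive[OF ring_U S YU, of "\<lambda>V. f V (X \<beta>)"] f_add by simp
  qed
  finally have "f x y = (\<Sum>\<beta>\<in>S. \<Sum>\<gamma>\<in>S. f (Y \<gamma>) (X \<beta>))" .
  moreover have "f (Y \<gamma>) (X \<beta>) \<in> qA0" if \<beta>\<gamma>: "\<beta> \<in> S" "\<gamma> \<in> S" for \<beta> \<gamma>
  proof -
    let ?c = "prod_mset (image_mset N \<gamma>)"
    note cmp = compare_bspan[OF Y[OF \<beta>\<gamma>(2)] \<beta>[OF \<beta>\<gamma>(2)] X[OF \<beta>\<gamma>(1)] \<beta>[OF \<beta>\<gamma>(1)]]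
    have f: "f (Y \<gamma>) (X \<beta>) = (?c - 1) * K (Y \<gamma>) (X \<beta>)"
      by (simp add: f_def cmp(1) algebra_simps)
    show ?thesis
    proof (cases "\<gamma> = \<beta>")
      case True
      have "K (Y \<beta>) (X \<beta>) = K (X \<beta>) (Y \<beta>)" using \<beta>\<gamma>(1) XU YU by (intro K_sym) auto
      moreover have "?c - 1 \<in> qA0" using N \<beta>[OF \<beta>\<gamma>(2)] by (intro prod_mset_one_mod_qA0) blast
      ultimately show ?thesis
        unfolding f using int[OF \<beta>\<gamma>(1)] True by (simp add: qA0_mult)
    next
      case False
      then show ?thesis unfolding f using cmp(2) by (simp add: qA0_0)
    qed
  qed
  ultimately have "f x y \<in> qA0" by (simp add: qA0_sum)
  then show ?thesis by (simp add: f_def)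
qed

end

theorem propositionB:
  fixes a :: "'i::countable \<Rightarrow> 'i \<Rightarrow> int" and s :: "'i \<Rightarrow> int"
    and \<nu> :: "'i \<times> nat \<Rightarrow> ratfun"
    and L :: "'i free \<Rightarrow> 'i free \<Rightarrow> ratfun"
    and b :: "'i \<times> nat \<Rightarrow> 'i free set"
    and e' :: "'i \<times> nat \<Rightarrow> 'i free set \<Rightarrow> 'i free set"
    and K :: "'i free set \<Rightarrow> 'i free set \<Rightarrow> ratfun"
  assumes datum: "borcherds_cartan a s"
    and nu_nonzero: "\<forall>g\<in>Iinf a. \<nu> g \<noteq> 0"
    and nu_positive: "\<forall>i\<in>Iim a - Iiso a. \<forall>l>0. one_mod_q_nonneg (\<nu> (i, l))"
    and lusztig: "lusztig_form a s \<nu> L"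
    and primitive: "primitive_generators a L b"
    and normalization:
      "\<forall>(i, l)\<in>Iinf a. Lform L (b (i, l)) (b (i, l)) = inverse (1 - qv powi (s i * (2 * int l)))"
    and derivations: "kashiwara_derivations a s L b e'"
    and kashiwara: "kashiwara_form a L b e' K"
  shows "\<forall>x\<in>carrier (Uminus a L). \<forall>y\<in>carrier (Uminus a L).
           integrally_paired a L b K x y \<longrightarrow> Lform L x y - K x y \<in> qA0"
proof -
  define N where "N g = Lform L (b g) (b g)" for g
  have N: "N g \<noteq> 0 \<and> N g - 1 \<in> qA0" if g: "g \<in> Iinf a" for g
  proof -
    obtain i l where il: "g = (i, l)" by (cases g)
    define n where "n = nat (s i * (2 * int l))"
    have "0 < s i" using datum by (simp add: borcherds_cartan_def)
    moreover have "0 < l" using g by (auto simp: il Iinf_def)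
    ultimately have "s i * (2 * int l) = int n" "0 < n" by (simp_all add: n_def)
    moreover have "N g = inverse (1 - qv powi (s i * (2 * int l)))"
      using normalization g by (auto simp: N_def il)
    ultimately have "N g = inverse (1 - qv ^ n)" by simp
    then show ?thesis using inverse_one_minus_qv_power[OF \<open>0 < n\<close>] by simp
  qed
  interpret kashiwara_algebra a s \<nu> L b e' K N
    by unfold_locales (use assms N in \<open>auto simp: N_def\<close>)
  show ?thesis using forms_congruent N by blast
qed

end
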